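(* Let $a,p\in[0,1]$, set $A:=[0,a)$ and $B:=[a,1]$, and let $W:[0,1]^2\to[0,1]$ be the graphon which is $0$ on $A^2$, $1$ on $B^2$, and $p$ everywhere else. Then $W$ is forced by $(\alpha,\omega,X_4)$; that is, every graphon $U$ such that $\alpha(U)=\alpha(W)$, $\omega(U)=\omega(W)$, and $X_4(U)$ and $X_4(W)$ have the same distribution, is weakly isomorphic to $W$.
   Context: A graphon is a measurable symmetric function $W:[0,1]^2\to[0,1]$ (Lebesgue measure on $[0,1]$). For an integer $k\ge 1$, the $k$-sample $\mathbb G(k,W)$ is the random graph on $\{1,\dots,k\}$ obtained by sampling $x_1,\dots,x_k\in[0,1]$ uniformly at random and making each pair $\{i,j\}\subseteq\{1,\dots,k\}$ with $i\ne j$ an edge with probability $W(x_i,x_j)$, all these choices being mutually independent. $X_k(W)$ denotes the number of edges of $\mathbb G(k,W)$. Two graphons $U,W$ are weakly isomorphic if $\mathbb G(k,U)$ and $\mathbb G(k,W)$ have the same distribution for every $k\in\mathbb N$. The independence ratio $\alpha(W)$ of a graphon $W$ is the supremum of the Lebesgue measure of measurable $S\subseteq[0,1]$ such that $W(x,y)=0$ for a.e. $(x,y)\in S^2$. The clique ratio is $\omega(W):=\alpha(1-W)$, i.e. the supremum of the measure of measurable $S\subseteq[0,1]$ with $W=1$ a.e. on $S^2$. *)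

theory Defs
  imports "HOL-Probability.Probability"
begin

text \<open>
  Graphons are represented by total functions on the plane; only their values on the unit square
  matter. Measurability is with respect to the complete (Lebesgue) sigma-algebra.
\<close>

definition graphon :: "(real \<times> real \<Rightarrow> real) \<Rightarrow> bool" where
  "graphon W \<longleftrightarrow>
     W \<in> borel_measurable (lebesgue_on ({0..1} \<times> {0..1})) \<and>
     (\<forall>x\<in>{0..1}. \<forall>y\<in>{0..1}. W (x, y) = W (y, x)) \<and>
     (\<forall>x\<in>{0..1}. \<forall>y\<in>{0..1}. W (x, y) \<in> {0..1})"

definition vertex_pairs :: "nat \<Rightarrow> nat set set" where
  "vertex_pairs k = {e. e \<subseteq> {1..k} \<and> card e = 2}"

text \<open>
  A graph on the vertex set \<open>{1..k}\<close> is given by its edge set, a subset of \<open>vertex_pairs k\<close>.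
  As \<open>W\<close> is symmetric, \<open>W (x (Min e), x (Max e))\<close> is \<open>W (x i, x j)\<close> for \<open>e = {i, j}\<close>.
\<close>

definition random_graph :: "nat \<Rightarrow> (real \<times> real \<Rightarrow> real) \<Rightarrow> (nat \<Rightarrow> real) \<Rightarrow> nat set set pmf" where
  "random_graph k W x =
     map_pmf (\<lambda>b. {e \<in> vertex_pairs k. b e})
       (Pi_pmf (vertex_pairs k) False (\<lambda>e. bernoulli_pmf (W (x (Min e), x (Max e)))))"

text \<open>
  The sampled points are distributed according to \<open>k\<close>-dimensional Lebesgue measure on the unit
  cube. The completion is needed because, for a Lebesgue measurable \<open>W\<close>, the function
  \<open>\<lambda>x. W (x i, x j)\<close> need not be measurable for the product sigma-algebra itself.
\<close>

definition sample_points :: "nat \<Rightarrow> (nat \<Rightarrow> real) measure" where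
  "sample_points k = completion (PiM {1..k} (\<lambda>_. restrict_space lborel {0..1}))"

definition sample :: "nat \<Rightarrow> (real \<times> real \<Rightarrow> real) \<Rightarrow> nat set set measure" where
  "sample k W = sample_points k \<bind> (\<lambda>x. measure_pmf (random_graph k W x))"

definition edge_count_distr :: "nat \<Rightarrow> (real \<times> real \<Rightarrow> real) \<Rightarrow> nat measure" where
  "edge_count_distr k W = distr (sample k W) (count_space UNIV) card"

definition weakly_isomorphic :: "(real \<times> real \<Rightarrow> real) \<Rightarrow> (real \<times> real \<Rightarrow> real) \<Rightarrow> bool" where
  "weakly_isomorphic U W \<longleftrightarrow> (\<forall>k\<ge>1. sample k U = sample k W)"

definition independence_ratio :: "(real \<times> real \<Rightarrow> real) \<Rightarrow> real" where
  "independence_ratio W =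
     Sup {measure lebesgue S | S. S \<in> sets lebesgue \<and> S \<subseteq> {0..1} \<and>
            (AE z in lebesgue. z \<in> S \<times> S \<longrightarrow> W z = 0)}"

definition clique_ratio :: "(real \<times> real \<Rightarrow> real) \<Rightarrow> real" where
  "clique_ratio W = independence_ratio (\<lambda>z. 1 - W z)"

definition step_graphon :: "real \<Rightarrow> real \<Rightarrow> real \<times> real \<Rightarrow> real" where
  "step_graphon a p z =
     (if z \<in> {0..<a} \<times> {0..<a} then 0
      else if z \<in> {a..1} \<times> {a..1} then 1
      else p)"

lemma graphon_step_graphon:
  assumes "a \<in> {0..1}" and "p \<in> {0..1}"
  shows "graphon (step_graphon a p)"
proof -
  have box: "I \<times> I \<in> sets (borel :: (real \<times> real) measure)" if "I \<in> sets borel" for I :: "real set"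
    using pair_measureI[OF that that] unfolding borel_prod .
  have "step_graphon a p \<in> borel_measurable lborel"
    unfolding step_graphon_def by (intro measurable_If_set measurable_const) (auto intro: box)
  from measurable_restrict_space1[OF measurable_completion[OF this]]
  have "step_graphon a p \<in> borel_measurable (lebesgue_on ({0..1} \<times> {0..1}))" .
  then show ?thesis
    using assms by (auto simp: graphon_def step_graphon_def)
qed

end

(*
  Almost disjointness of independent sets and cliques, together with alpha + omega = 1, forces U to
  be 0 on S x S and 1 on T x T for some partition of [0,1] into S and T with |S| = a; no compactness
  is needed, as the unions of maximizing sequences of independent sets and of cliques already work.
  Let g be the difference of U and the corresponding step graphon; it vanishes off S x T and T x S.
  The symmetric polynomials in the variables 1_e - p, e ranging over the six vertex pairs, depend
  only on the number of edges. Degree one shows that the integral of g is 0. Degree two then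
  determines the second moment of the degrees, and as the degrees of the step graphon are constant
  on S and on T, the degree function G of g vanishes a.e. In the product of all six variables, g
  contributes only stars, which integrate to multiples of G^3, and 4-cycles with weight -p(1-p);
  hence g has C4-density 0 unless p is 0 or 1. C4-density 0 forces g = 0 a.e., and for p = 0 or
  p = 1 the function g has constant sign and integral 0.
*)
theory Submission
  imports Defs
begin

section \<open>Sampling from a graphon\<close>

text \<open>Centring at \<open>p\<close> is what keeps the degree-six computation short:
  \<open>W - p\<close> vanishes between the two parts and \<open>g\<close> vanishes inside them, so
  at each pair of points at most one of the two is nonzero. With two points in each part, the four
  crossing pairs form a 4-cycle and the two inner pairs give the factors \<open>-p\<close> and
  \<open>1 - p\<close>; this is why samples of size 4 suffice. In the second moment of the degrees,
  the mixed term reduces to the integrals of \<open>G\<close> over everything and over S, and by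
  symmetry of \<open>g\<close> the latter is half of the former. A union of independent sets is in
  general not independent; the relation alpha + omega = 1 forces the measures of the maximizing sets
  to converge to that of their union, which rescues independence. The technical obstacle is
  measurability: U is only Lebesgue measurable, while Fubini's theorem is applied on product
  sigma-algebras. Therefore U is replaced by a Borel function of exact block form that agrees with
  it a.e., and the kernel identities can be stated pointwise.\<close>

abbreviation unit_lborel :: "real measure" where
  "unit_lborel \<equiv> restrict_space lborel {0..1}"

interpretation unit_lborel: prob_space unit_lborel
  by (rule prob_spaceI) (simp add: emeasure_restrict_space space_restrict_space)

interpretation unit_lborel2: pair_prob_space unit_lborel unit_lborel ..

text \<open>Restriction to the indices \<open>{i, j}\<close> preserves product measures, and over
  two indices the product is the pair measure. This carries planar a.e. statements and integrals
  over to pairs of sample points.\<close>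

lemma (in prob_space) distr_PiM_pair:
  assumes I: "finite I" "i \<in> I" "j \<in> I" and ij: "i \<noteq> j"
  shows "distr (PiM I (\<lambda>_. M)) (M \<Otimes>\<^sub>M M) (\<lambda>x. (x i, x j)) = M \<Otimes>\<^sub>M M"
proof (rule measure_eqI)
  interpret P: product_prob_space "\<lambda>_. M" ..
  fix A assume "A \<in> sets (distr (PiM I (\<lambda>_. M)) (M \<Otimes>\<^sub>M M) (\<lambda>x. (x i, x j)))"
  then have A[measurable]: "A \<in> sets (M \<Otimes>\<^sub>M M)" by simp
  have comp: "(\<lambda>x. (x i, x j)) \<in> measurable (PiM K (\<lambda>_. M)) (M \<Otimes>\<^sub>M M)" if "i \<in> K" "j \<in> K" for K
    using that by measurable
  have "emeasure (distr (PiM I (\<lambda>_. M)) (M \<Otimes>\<^sub>M M) (\<lambda>x. (x i, x j))) A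
      = (\<integral>\<^sup>+x. indicator A (x i, x j) \<partial>PiM I (\<lambda>_. M))"
    by (subst nn_integral_indicator[symmetric], simp, subst nn_integral_distr)
       (use I in \<open>auto intro!: comp\<close>)
  also have "\<dots> = (\<integral>\<^sup>+x. indicator A (restrict x {i, j} i, restrict x {i, j} j) \<partial>PiM I (\<lambda>_. M))"
    by simp
  also have "\<dots> = (\<integral>\<^sup>+x. indicator A (x i, x j) \<partial>PiM {i, j} (\<lambda>_. M))"
  proof -
    have [measurable]: "(\<lambda>x. indicator A (x i, x j) :: ennreal) \<in> borel_measurable (PiM {i, j} (\<lambda>_. M))"
      using comp[of "{i, j}"] by measurable
    have D: "distr (PiM I (\<lambda>_. M)) (PiM {i, j} (\<lambda>_. M)) (\<lambda>f. restrict f {i, j}) = PiM {i, j} (\<lambda>_. M)"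
      using I by (intro P.distr_restrict[symmetric]) auto
    have "(\<integral>\<^sup>+x. indicator A (x i, x j) \<partial>PiM {i, j} (\<lambda>_. M)) = (\<integral>\<^sup>+x. indicator A (x i, x j)
        \<partial>distr (PiM I (\<lambda>_. M)) (PiM {i, j} (\<lambda>_. M)) (\<lambda>f. restrict f {i, j}))"
      by (simp only: D)
    also have "\<dots> = (\<integral>\<^sup>+x. indicator A (restrict x {i, j} i, restrict x {i, j} j) \<partial>PiM I (\<lambda>_. M))"
      using I by (intro nn_integral_distr measurable_restrict_subset) auto
    finally show ?thesis by simp
  qed
  also have "\<dots> = (\<integral>\<^sup>+z. indicator A (fst z, snd z) \<partial>(M \<Otimes>\<^sub>M M))"
    using ij by (intro P.product_nn_integral_pair[of "\<lambda>a b. indicator A (a, b)"]) (auto simp: case_prod_beta')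
  also have "\<dots> = emeasure (M \<Otimes>\<^sub>M M) A" by simp
  finally show "emeasure (distr (PiM I (\<lambda>_. M)) (M \<Otimes>\<^sub>M M) (\<lambda>x. (x i, x j))) A = emeasure (M \<Otimes>\<^sub>M M) A" .
qed simp

lemma (in prob_space) AE_PiM_pair:
  assumes "AE z in M \<Otimes>\<^sub>M M. P z" and I: "finite I" "i \<in> I" "j \<in> I" "i \<noteq> j"
  shows "AE x in PiM I (\<lambda>_. M). P (x i, x j)"
proof (rule AE_distrD[where f = "\<lambda>x. (x i, x j)" and P = P])
  show "(\<lambda>x. (x i, x j)) \<in> measurable (PiM I (\<lambda>_. M)) (M \<Otimes>\<^sub>M M)"
    using I by measurable
  show "AE z in distr (PiM I (\<lambda>_. M)) (M \<Otimes>\<^sub>M M) (\<lambda>x. (x i, x j)). P z"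
    by (subst distr_PiM_pair[OF I]) (rule assms(1))
qed

lemma finite_vertex_pairs [simp]: "finite (vertex_pairs k)"
  unfolding vertex_pairs_def by (rule finite_subset[of _ "Pow {1..k}"]) auto

lemma vertex_pairE:
  assumes "e \<in> vertex_pairs k"
  obtains i j where "e = {i, j}" "Min e = i" "Max e = j" "i < j" "i \<in> {1..k}" "j \<in> {1..k}"
proof -
  obtain a b where ab: "e = {a, b}" "a \<noteq> b" "{a, b} \<subseteq> {1..k}"
    using assms by (auto simp: vertex_pairs_def card_2_iff)
  then show thesis
    using that[of "min a b" "max a b"] by (cases "a < b") (auto simp: min_def max_def)
qed

lemma random_graph_cong:
  assumes "\<And>e. e \<in> vertex_pairs k \<Longrightarrow> U (x (Min e), x (Max e)) = W (y (Min e), y (Max e))"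
  shows "random_graph k U x = random_graph k W y"
  unfolding random_graph_def using assms by (intro arg_cong2[where f = map_pmf] Pi_pmf_cong) auto

lemma AE_random_graph_eq:
  assumes "AE z in unit_lborel \<Otimes>\<^sub>M unit_lborel. U z = W z"
  shows "AE x in PiM {1..k} (\<lambda>_. unit_lborel). random_graph k U x = random_graph k W x"
proof -
  have "AE x in PiM {1..k} (\<lambda>_. unit_lborel). \<forall>e\<in>vertex_pairs k.
      U (x (Min e), x (Max e)) = W (x (Min e), x (Max e))"
  proof (rule AE_finite_allI)
    fix e assume "e \<in> vertex_pairs k"
    then show "AE x in PiM {1..k} (\<lambda>_. unit_lborel). U (x (Min e), x (Max e)) = W (x (Min e), x (Max e))"
      by (elim vertex_pairE) (auto intro!: unit_lborel.AE_PiM_pair[OF assms])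
  qed simp
  then show ?thesis
    by eventually_elim (auto intro: random_graph_cong)
qed

text \<open>The edge functions range over the finite set \<open>H\<close>, so the probability of an
  event is a finite sum of products of values of \<open>W\<close>. \<open>M\<close> is kept general
  because the result is needed again for the label laws in
  \<open>sample_split_graphon_cong\<close>.\<close>

lemma measurable_random_graph:
  fixes M :: "real measure"
  assumes [measurable]: "W \<in> borel_measurable (M \<Otimes>\<^sub>M M)"
  shows "(\<lambda>x. measure_pmf (random_graph k W x)) \<in>
    measurable (PiM {1..k} (\<lambda>_. M)) (subprob_algebra (count_space UNIV))"
proof (rule measurable_subprob_algebra)
  fix A :: "nat set set set"
  define H where "H = PiE_dflt (vertex_pairs k) False (\<lambda>_. UNIV :: bool set)"
  have finH: "finite H" unfolding H_def by (rule finite_PiE_dflt) auto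
  have W_meas: "(\<lambda>x. W (x (Min e), x (Max e))) \<in> borel_measurable (PiM {1..k} (\<lambda>_. M))"
    if "e \<in> vertex_pairs k" for e
    using that by (elim vertex_pairE) (simp, measurable)
  \<comment> \<open>\<open>bernoulli_pmf\<close> clamps its parameter to the unit interval; the
    clamped form is valid for every real-valued \<open>W\<close>.\<close>
  have "emeasure (measure_pmf (random_graph k W x)) A =
     ennreal (\<Sum>h\<in>H \<inter> {b. {e \<in> vertex_pairs k. b e} \<in> A}.
       \<Prod>e\<in>vertex_pairs k. if h e then min 1 (max 0 (W (x (Min e), x (Max e))))
                           else 1 - min 1 (max 0 (W (x (Min e), x (Max e)))))" for x
  proof -
    let ?q = "Pi_pmf (vertex_pairs k) False (\<lambda>e. bernoulli_pmf (W (x (Min e), x (Max e))))"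
    let ?B = "{b. {e \<in> vertex_pairs k. b e} \<in> A}"
    have sub: "set_pmf ?q \<subseteq> H"
      using set_Pi_pmf_subset'[OF finite_vertex_pairs, of k False] by (fastforce simp: H_def PiE_dflt_def)
    have "measure (measure_pmf (random_graph k W x)) A = measure (measure_pmf ?q) ?B"
      by (simp add: random_graph_def vimage_def)
    also have "\<dots> = measure (measure_pmf ?q) (H \<inter> ?B)"
      using sub by (intro measure_eq_AE) (auto simp: AE_measure_pmf_iff)
    also have "\<dots> = (\<Sum>h\<in>H \<inter> ?B. pmf ?q h)"
      using finH by (intro measure_measure_pmf_finite) auto
    also have "\<dots> = (\<Sum>h\<in>H \<inter> ?B. \<Prod>e\<in>vertex_pairs k.
        if h e then min 1 (max 0 (W (x (Min e), x (Max e)))) else 1 - min 1 (max 0 (W (x (Min e), x (Max e)))))"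
    proof (rule sum.cong[OF refl])
      fix h assume "h \<in> H \<inter> ?B"
      then have "pmf ?q h = (\<Prod>e\<in>vertex_pairs k. pmf (bernoulli_pmf (W (x (Min e), x (Max e)))) (h e))"
        by (intro pmf_Pi') (auto simp: H_def PiE_dflt_def)
      also have "\<dots> = (\<Prod>e\<in>vertex_pairs k.
        if h e then min 1 (max 0 (W (x (Min e), x (Max e)))) else 1 - min 1 (max 0 (W (x (Min e), x (Max e)))))"
        by (intro prod.cong) (auto simp: bernoulli_pmf.rep_eq)
      finally show "pmf ?q h = (\<Prod>e\<in>vertex_pairs k.
        if h e then min 1 (max 0 (W (x (Min e), x (Max e)))) else 1 - min 1 (max 0 (W (x (Min e), x (Max e)))))" .
    qed
    finally show ?thesis by (simp add: measure_pmf.emeasure_eq_measure)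
  qed
  moreover have "(\<lambda>x. ennreal (\<Sum>h\<in>H \<inter> {b. {e \<in> vertex_pairs k. b e} \<in> A}.
       \<Prod>e\<in>vertex_pairs k. if h e then min 1 (max 0 (W (x (Min e), x (Max e))))
                           else 1 - min 1 (max 0 (W (x (Min e), x (Max e))))))
     \<in> borel_measurable (PiM {1..k} (\<lambda>_. M))"
    by (intro measurable_compose[OF _ measurable_ennreal] borel_measurable_sum borel_measurable_prod measurable_If
      borel_measurable_min borel_measurable_max borel_measurable_const borel_measurable_diff W_meas) auto
  ultimately show "(\<lambda>x. emeasure (measure_pmf (random_graph k W x)) A)
      \<in> borel_measurable (PiM {1..k} (\<lambda>_. M))"
    by simp
qed (auto intro: prob_space_imp_subprob_space measure_pmf.prob_space_axioms)

lemma measurable_completion_AE_cong: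
  assumes f: "f \<in> measurable M N" and ae: "AE x in M. f x = g x" and g: "g \<in> space M \<rightarrow> space N"
  shows "g \<in> measurable (completion M) N"
proof (rule measurableI)
  fix A assume "A \<in> sets N"
  then have *: "f -` A \<inter> space M \<in> sets (completion M)" using f by (auto dest: measurable_sets)
  have **: "AE x in completion M. x \<in> f -` A \<inter> space M \<longleftrightarrow> x \<in> g -` A \<inter> space M"
    using AE_completion[OF ae] by (rule AE_mp) (simp add: AE_I2)
  show "g -` A \<inter> space (completion M) \<in> sets (completion M)"
    using completion.in_sets_AE[OF ** *] by simp
qed (use g in auto)

text \<open>A planar null set affects the random graph only on a null set of sample points, and the
  completion in \<open>sample_points\<close> then makes the kernel of \<open>U\<close> measurable.
  This permits passing from a Lebesgue measurable graphon to a Borel version.\<close>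

lemma sample_cong_AE:
  assumes W: "W \<in> borel_measurable (unit_lborel \<Otimes>\<^sub>M unit_lborel)"
    and ae: "AE z in unit_lborel \<Otimes>\<^sub>M unit_lborel. U z = W z"
  shows "sample k U = sample k W"
  unfolding sample_def sample_points_def
proof (rule bind_cong_AE[OF refl])
  note W' = measurable_random_graph[OF W, of k]
  note eq = AE_random_graph_eq[OF ae, of k]
  show "(\<lambda>x. measure_pmf (random_graph k W x)) \<in>
      measurable (completion (PiM {1..k} (\<lambda>_. unit_lborel))) (subprob_algebra (count_space UNIV))"
    by (rule measurable_completion[OF W'])
  show "(\<lambda>x. measure_pmf (random_graph k U x)) \<in>
      measurable (completion (PiM {1..k} (\<lambda>_. unit_lborel))) (subprob_algebra (count_space UNIV))"
    by (rule measurable_completion_AE_cong[OF W'])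
       (auto intro: AE_mp[OF eq] measure_pmf_in_subprob_space)
  show "AE x in completion (PiM {1..k} (\<lambda>_. unit_lborel)).
      measure_pmf (random_graph k U x) = measure_pmf (random_graph k W x)"
    by (rule AE_completion, rule AE_mp[OF eq]) simp
qed

lemma emeasure_sample:
  assumes W: "W \<in> borel_measurable (unit_lborel \<Otimes>\<^sub>M unit_lborel)"
  shows "emeasure (sample k W) A =
    (\<integral>\<^sup>+x. emeasure (measure_pmf (random_graph k W x)) A \<partial>PiM {1..k} (\<lambda>_. unit_lborel))"
proof -
  have "space (PiM {1..k} (\<lambda>_. unit_lborel)) \<noteq> {}"
    by (auto simp: space_PiM PiE_eq_empty_iff space_restrict_space)
  then show ?thesis
    unfolding sample_def sample_points_def
    by (subst emeasure_bind[OF _ measurable_completion[OF measurable_random_graph[OF W]]])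
       (simp_all add: nn_integral_completion)
qed

lemma sets_sample:
  assumes W: "W \<in> borel_measurable (unit_lborel \<Otimes>\<^sub>M unit_lborel)"
  shows "sets (sample k W) = UNIV"
proof -
  have "space (PiM {1..k} (\<lambda>_. unit_lborel)) \<noteq> {}"
    by (auto simp: space_PiM PiE_eq_empty_iff space_restrict_space)
  then show ?thesis
    unfolding sample_def sample_points_def
    by (subst sets_bind[where N = "count_space UNIV"]) auto
qed

lemma integral_sample:
  fixes f :: "nat set set \<Rightarrow> real"
  assumes W: "W \<in> borel_measurable (unit_lborel \<Otimes>\<^sub>M unit_lborel)"
    and B: "\<And>g. \<bar>f g\<bar> \<le> B"
  shows "(\<integral>g. f g \<partial>sample k W) =
    (\<integral>x. measure_pmf.expectation (random_graph k W x) f \<partial>PiM {1..k} (\<lambda>_. unit_lborel))"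
proof -
  interpret C: prob_space "completion (PiM {1..k} (\<lambda>_. unit_lborel))"
    by (intro prob_space.prob_space_completion prob_space_PiM unit_lborel.prob_space_axioms)
  note K = measurable_random_graph[OF W, of k]
  have "(\<integral>g. f g \<partial>sample k W) =
      (\<integral>x. measure_pmf.expectation (random_graph k W x) f \<partial>completion (PiM {1..k} (\<lambda>_. unit_lborel)))"
    unfolding sample_def sample_points_def
    by (rule integral_bind[where K = "count_space UNIV" and B = B and B' = 1])
       (use B measurable_completion[OF K] C.not_empty C.finite_measure_axioms measure_pmf.emeasure_space_1 in auto)
  also have "\<dots> = (\<integral>x. measure_pmf.expectation (random_graph k W x) f \<partial>PiM {1..k} (\<lambda>_. unit_lborel))"
  proof (rule integral_completion)
    have "(\<lambda>M. integral\<^sup>L M f) \<in> borel_measurable (subprob_algebra (count_space UNIV))"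
      by (rule integral_measurable_subprob_algebra) simp
    then show "(\<lambda>x. measure_pmf.expectation (random_graph k W x) f) \<in> borel_measurable (PiM {1..k} (\<lambda>_. unit_lborel))"
      by (rule measurable_compose[OF K])
  qed
  finally show ?thesis .
qed

section \<open>Moments of the edge count\<close>

text \<open>Given the points, the edges are independent and each \<open>indicator g e - p\<close>
  has mean \<open>W - p\<close>; the range hypothesis ensures that no Bernoulli parameter is
  clamped.\<close>

lemma expectation_random_graph_prod:
  assumes F: "F \<subseteq> vertex_pairs k"
    and W: "\<And>e. e \<in> vertex_pairs k \<Longrightarrow> W (x (Min e), x (Max e)) \<in> {0..1}"
  shows "measure_pmf.expectation (random_graph k W x) (\<lambda>g. \<Prod>e\<in>F. indicator g e - p) =
    (\<Prod>e\<in>F. W (x (Min e), x (Max e)) - p)"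
proof -
  let ?D = "\<lambda>e. bernoulli_pmf (W (x (Min e), x (Max e)))"
  let ?q = "Pi_pmf (vertex_pairs k) False ?D"
  have fin: "finite F" using F finite_subset by fastforce
  have "measure_pmf.expectation (random_graph k W x) (\<lambda>g. \<Prod>e\<in>F. indicator g e - p) =
      measure_pmf.expectation ?q (\<lambda>b. \<Prod>e\<in>F. of_bool (b e) - p)"
    unfolding random_graph_def integral_map_pmf
    using F by (intro integral_cong_AE) (auto simp: AE_measure_pmf_iff indicator_def intro!: prod.cong)
  also have "\<dots> = (\<Prod>e\<in>F. measure_pmf.expectation ?q (\<lambda>b. of_bool (b e) - p))"
  proof (rule prob_space.indep_vars_lebesgue_integral[OF measure_pmf.prob_space_axioms fin])
    have "prob_space.indep_vars (measure_pmf ?q) (\<lambda>_. count_space UNIV) (\<lambda>e b. b e) F"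
      by (rule prob_space.indep_vars_subset[OF measure_pmf.prob_space_axioms indep_vars_Pi_pmf F]) simp
    from prob_space.indep_vars_compose2[OF measure_pmf.prob_space_axioms this,
        where N = "\<lambda>_. borel" and Y = "\<lambda>_ b. of_bool b - p"]
    show "prob_space.indep_vars (measure_pmf ?q) (\<lambda>_. borel) (\<lambda>e b. of_bool (b e) - p) F" by simp
    show "integrable (measure_pmf ?q) (\<lambda>b. of_bool (b e) - p)" for e
      by (rule measure_pmf.integrable_const_bound[where B = "1 + \<bar>p\<bar>"]) auto
  qed
  also have "\<dots> = (\<Prod>e\<in>F. W (x (Min e), x (Max e)) - p)"
  proof (rule prod.cong[OF refl])
    fix e assume "e \<in> F"
    with F have e: "e \<in> vertex_pairs k" by auto
    have "measure_pmf.expectation ?q (\<lambda>b. of_bool (b e) - p) =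
        measure_pmf.expectation (map_pmf (\<lambda>b. b e) ?q) (\<lambda>b. of_bool b - p)"
      by simp
    also have "map_pmf (\<lambda>b. b e) ?q = ?D e"
      using e by (simp add: Pi_pmf_component)
    also have "measure_pmf.expectation (?D e) (\<lambda>b. of_bool b - p) = W (x (Min e), x (Max e)) - p"
      using W[OF e] by (simp add: integral_bernoulli_pmf algebra_simps)
    finally show "measure_pmf.expectation ?q (\<lambda>b. of_bool (b e) - p) = W (x (Min e), x (Max e)) - p" .
  qed
  finally show ?thesis .
qed

lemma random_graph_subset: "g \<in> set_pmf (random_graph k W x) \<Longrightarrow> g \<subseteq> vertex_pairs k"
  by (auto simp: random_graph_def)

lemma integrable_random_graph: "integrable (measure_pmf (random_graph k W x)) (f :: _ \<Rightarrow> real)"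
proof (rule integrable_measure_pmf_finite)
  show "finite (set_pmf (random_graph k W x))"
    by (rule finite_subset[of _ "Pow (vertex_pairs k)"]) (auto dest: random_graph_subset)
qed

lemma edge_count_distr_eqD:
  fixes h :: "nat set set \<Rightarrow> real"
  assumes U: "U \<in> borel_measurable (unit_lborel \<Otimes>\<^sub>M unit_lborel)"
    and W: "W \<in> borel_measurable (unit_lborel \<Otimes>\<^sub>M unit_lborel)"
    and eq: "edge_count_distr k U = edge_count_distr k W"
    and h: "\<And>g. g \<subseteq> vertex_pairs k \<Longrightarrow> h g = \<phi> (card g)"
  shows "(\<integral>x. measure_pmf.expectation (random_graph k U x) h \<partial>PiM {1..k} (\<lambda>_. unit_lborel)) =
    (\<integral>x. measure_pmf.expectation (random_graph k W x) h \<partial>PiM {1..k} (\<lambda>_. unit_lborel))"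
proof -
  define N where "N = card (vertex_pairs k)"
  \<comment> \<open>The cut-off beyond the largest possible edge count makes the function bounded on
    all of \<open>nat\<close>, as \<open>integral_sample\<close> requires, and changes no value on a
    graph that occurs.\<close>
  define \<psi> where "\<psi> n = (if n \<le> N then \<phi> n else 0)" for n
  have \<psi>_bound: "\<bar>\<psi> n\<bar> \<le> (\<Sum>i\<le>N. \<bar>\<phi> i\<bar>)" for n
    by (auto simp: \<psi>_def intro!: member_le_sum sum_nonneg)
  have "(\<integral>n. \<psi> n \<partial>edge_count_distr k V) =
      (\<integral>x. measure_pmf.expectation (random_graph k V x) h \<partial>PiM {1..k} (\<lambda>_. unit_lborel))"
    if V: "V \<in> borel_measurable (unit_lborel \<Otimes>\<^sub>M unit_lborel)" for V
  proof -
    have "(\<integral>n. \<psi> n \<partial>edge_count_distr k V) = (\<integral>g. \<psi> (card g) \<partial>sample k V)"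
      unfolding edge_count_distr_def by (rule integral_distr) (auto simp: measurable_def sets_sample[OF V])
    also have "\<dots> = (\<integral>x. measure_pmf.expectation (random_graph k V x) (\<lambda>g. \<psi> (card g)) \<partial>PiM {1..k} (\<lambda>_. unit_lborel))"
      by (rule integral_sample[OF V \<psi>_bound])
    also have "\<dots> = (\<integral>x. measure_pmf.expectation (random_graph k V x) h \<partial>PiM {1..k} (\<lambda>_. unit_lborel))"
    proof (rule Bochner_Integration.integral_cong[OF refl])
      fix x
      have "\<psi> (card g) = h g" if "g \<subseteq> vertex_pairs k" for g
        using h[OF that] card_mono[OF finite_vertex_pairs that] by (simp add: \<psi>_def N_def)
      then show "measure_pmf.expectation (random_graph k V x) (\<lambda>g. \<psi> (card g)) =
          measure_pmf.expectation (random_graph k V x) h"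
        by (intro integral_cong_AE) (auto simp: AE_measure_pmf_iff dest!: random_graph_subset)
    qed
    finally show ?thesis .
  qed
  from this[OF U] this[OF W] eq show ?thesis by simp
qed

section \<open>Symmetric polynomials in the centred edge indicators\<close>

lemma sum_indicator_minus:
  fixes p :: real
  assumes "finite A" "g \<subseteq> A"
  shows "(\<Sum>e\<in>A. (indicator g e - p) ^ m) = card g * (1 - p) ^ m + (card A - card g) * (- p) ^ m"
proof -
  have fin: "finite g" using assms finite_subset by blast
  have "(\<Sum>e\<in>A. (indicator g e - p) ^ m) = (\<Sum>e\<in>A - g. (indicator g e - p) ^ m) + (\<Sum>e\<in>g. (indicator g e - p) ^ m)"
    by (rule sum.subset_diff[OF assms(2,1)])
  also have "\<dots> = (\<Sum>e\<in>A - g. (- p) ^ m) + (\<Sum>e\<in>g. (1 - p) ^ m)"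
    by (intro arg_cong2[where f = "(+)"] sum.cong) auto
  finally show ?thesis
    using assms fin by (simp add: card_Diff_subset card_mono of_nat_diff)
qed

lemma prod_indicator_minus:
  fixes p :: real
  assumes "finite A" "g \<subseteq> A"
  shows "(\<Prod>e\<in>A. indicator g e - p) = (1 - p) ^ card g * (- p) ^ (card A - card g)"
proof -
  have fin: "finite g" using assms finite_subset by blast
  have "(\<Prod>e\<in>A. indicator g e - p) = (\<Prod>e\<in>A - g. indicator g e - p) * (\<Prod>e\<in>g. indicator g e - p)"
    by (rule prod.subset_diff[OF assms(2,1)])
  also have "\<dots> = (\<Prod>e\<in>A - g. - p) * (\<Prod>e\<in>g. 1 - p)"
    by (intro arg_cong2[where f = "(*)"] prod.cong) auto
  finally show ?thesis
    using assms fin by (simp add: card_Diff_subset mult.commute)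
qed

text \<open>Reduces the sum over ordered pairs of distinct edges to two power sums, which by
  \<open>sum_indicator_minus\<close> depend only on the edge count.\<close>

lemma sum_distinct_pairs:
  fixes y :: "'a \<Rightarrow> real"
  assumes "finite A"
  shows "(\<Sum>e\<in>A. \<Sum>f\<in>A - {e}. y e * y f) = (\<Sum>e\<in>A. y e) ^ 2 - (\<Sum>e\<in>A. y e ^ 2)"
proof -
  have "(\<Sum>f\<in>A - {e}. y e * y f) = y e * (\<Sum>f\<in>A. y f) - y e ^ 2" if "e \<in> A" for e
    using assms that by (simp add: sum_distrib_left sum_diff1 power2_eq_square)
  then show ?thesis
    by (simp add: sum_subtractf sum_distrib_right[symmetric] power2_eq_square)
qed

context
  fixes U W :: "real \<times> real \<Rightarrow> real" and k :: nat and p :: real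
  assumes U: "U \<in> borel_measurable (unit_lborel \<Otimes>\<^sub>M unit_lborel)" "\<And>z. U z \<in> {0..1}"
    and W: "W \<in> borel_measurable (unit_lborel \<Otimes>\<^sub>M unit_lborel)" "\<And>z. W z \<in> {0..1}"
    and eq: "edge_count_distr k U = edge_count_distr k W"
begin

lemma edge_count_distr_eq_sum:
  "(\<integral>x. (\<Sum>e\<in>vertex_pairs k. U (x (Min e), x (Max e)) - p) \<partial>PiM {1..k} (\<lambda>_. unit_lborel)) =
   (\<integral>x. (\<Sum>e\<in>vertex_pairs k. W (x (Min e), x (Max e)) - p) \<partial>PiM {1..k} (\<lambda>_. unit_lborel))"
proof -
  let ?h = "\<lambda>g. \<Sum>e\<in>vertex_pairs k. indicator g e - p"
  have "measure_pmf.expectation (random_graph k V x) ?h =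
      (\<Sum>e\<in>vertex_pairs k. V (x (Min e), x (Max e)) - p)" if "\<And>z. V z \<in> {0..1}" for V x
    using expectation_random_graph_prod[of "{e}" k V x p for e] that
    by (subst Bochner_Integration.integral_sum) (auto simp: integrable_random_graph intro!: sum.cong)
  moreover have "?h g = card g * (1 - p) + (card (vertex_pairs k) - card g) * (- p)"
    if "g \<subseteq> vertex_pairs k" for g
    using sum_indicator_minus[OF finite_vertex_pairs that, of p 1] by simp
  ultimately show ?thesis
    using edge_count_distr_eqD[OF U(1) W(1) eq, of ?h
      "\<lambda>n. n * (1 - p) + (card (vertex_pairs k) - n) * (- p)"] U(2) W(2)
    by simp
qed

text \<open>The diagonal is left out because a squared centred indicator does not in general have
  mean \<open>(W - p)^2\<close>; for distinct edges, independence gives the product of the two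
  means.\<close>

lemma edge_count_distr_eq_sum_pairs:
  "(\<integral>x. (\<Sum>e\<in>vertex_pairs k. \<Sum>f\<in>vertex_pairs k - {e}.
       (U (x (Min e), x (Max e)) - p) * (U (x (Min f), x (Max f)) - p)) \<partial>PiM {1..k} (\<lambda>_. unit_lborel)) =
   (\<integral>x. (\<Sum>e\<in>vertex_pairs k. \<Sum>f\<in>vertex_pairs k - {e}.
       (W (x (Min e), x (Max e)) - p) * (W (x (Min f), x (Max f)) - p)) \<partial>PiM {1..k} (\<lambda>_. unit_lborel))"
proof -
  let ?h = "\<lambda>g. \<Sum>e\<in>vertex_pairs k. \<Sum>f\<in>vertex_pairs k - {e}. \<Prod>e\<in>{e, f}. indicator g e - p"
  have "measure_pmf.expectation (random_graph k V x) ?h =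
      (\<Sum>e\<in>vertex_pairs k. \<Sum>f\<in>vertex_pairs k - {e}.
        (V (x (Min e), x (Max e)) - p) * (V (x (Min f), x (Max f)) - p))" if V: "\<And>z. V z \<in> {0..1}" for V x
  proof -
    have "measure_pmf.expectation (random_graph k V x) ?h =
      (\<Sum>e\<in>vertex_pairs k. \<Sum>f\<in>vertex_pairs k - {e}. \<Prod>e\<in>{e, f}. V (x (Min e), x (Max e)) - p)"
      using V by (simp add: Bochner_Integration.integral_sum integrable_random_graph
        expectation_random_graph_prod del: prod.insert)
    also have "\<dots> = (\<Sum>e\<in>vertex_pairs k. \<Sum>f\<in>vertex_pairs k - {e}.
        (V (x (Min e), x (Max e)) - p) * (V (x (Min f), x (Max f)) - p))"
      by (intro sum.cong refl) (simp add: eq_commute)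
    finally show ?thesis .
  qed
  moreover have "?h g = (card g * (1 - p) + (card (vertex_pairs k) - card g) * (- p)) ^ 2
      - (card g * (1 - p) ^ 2 + (card (vertex_pairs k) - card g) * (- p) ^ 2)"
    if "g \<subseteq> vertex_pairs k" for g
  proof -
    have "?h g = (\<Sum>e\<in>vertex_pairs k. \<Sum>f\<in>vertex_pairs k - {e}. (indicator g e - p) * (indicator g f - p))"
      by (intro sum.cong refl) (simp add: eq_commute)
    then show ?thesis
      using sum_indicator_minus[OF finite_vertex_pairs that, of p 1]
        sum_indicator_minus[OF finite_vertex_pairs that, of p 2]
      by (simp add: sum_distinct_pairs)
  qed
  ultimately show ?thesis
    using edge_count_distr_eqD[OF U(1) W(1) eq, of ?h
      "\<lambda>n. (n * (1 - p) + (card (vertex_pairs k) - n) * (- p)) ^ 2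
        - (n * (1 - p) ^ 2 + (card (vertex_pairs k) - n) * (- p) ^ 2)"] U(2) W(2)
    by simp
qed

lemma edge_count_distr_eq_prod:
  "(\<integral>x. (\<Prod>e\<in>vertex_pairs k. U (x (Min e), x (Max e)) - p) \<partial>PiM {1..k} (\<lambda>_. unit_lborel)) =
   (\<integral>x. (\<Prod>e\<in>vertex_pairs k. W (x (Min e), x (Max e)) - p) \<partial>PiM {1..k} (\<lambda>_. unit_lborel))"
  using edge_count_distr_eqD[OF U(1) W(1) eq, of "\<lambda>g. \<Prod>e\<in>vertex_pairs k. indicator g e - p"
    "\<lambda>n. (1 - p) ^ n * (- p) ^ (card (vertex_pairs k) - n)"] prod_indicator_minus[of "vertex_pairs k"] U(2) W(2)
  by (simp add: expectation_random_graph_prod)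

end

section \<open>Independent sets and cliques\<close>

lemma space_unit_lborel: "space unit_lborel = {0..1}"
  by (simp add: space_restrict_space)

lemma sets_unit_lborel: "S \<in> sets unit_lborel \<longleftrightarrow> S \<in> sets borel \<and> S \<subseteq> {0..1}"
  by (subst sets_restrict_space_iff) auto

lemma measure_unit_lborel:
  assumes "S \<subseteq> {0..1}"
  shows "measure unit_lborel S = measure lborel S"
  using assms by (intro measure_restrict_space) auto

text \<open>A Borel null set of the plane has null sections at almost every point. This survives
  restriction to the unit interval, and the sections reassemble to a null set of the unit
  square.\<close>

lemma AE_unit_square:
  assumes "AE z in lborel. P z"
  shows "AE z in unit_lborel \<Otimes>\<^sub>M unit_lborel. P z"
proof -
  from assms obtain N where N: "{z. \<not> P z} \<subseteq> N" "N \<in> null_sets lborel"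
    by (auto elim!: AE_E simp: null_setsI)
  have Nm: "N \<in> sets (borel \<Otimes>\<^sub>M borel)" unfolding borel_prod using null_setsD2[OF N(2)] by simp
  have "AE z in lborel \<Otimes>\<^sub>M lborel. z \<notin> N"
    unfolding lborel_prod using N(2) by (rule AE_not_in)
  then have "AE x in lborel. AE y in lborel. (x, y) \<notin> N"
    by (rule lborel_pair.AE_pair)
  then have "AE x in unit_lborel. AE y in unit_lborel. (x, y) \<notin> N"
    by (simp add: AE_restrict_space_iff) (auto elim: AE_mp)
  moreover have "{z \<in> space (unit_lborel \<Otimes>\<^sub>M unit_lborel). fst z \<in> UNIV \<and> z \<notin> N} \<in> sets (unit_lborel \<Otimes>\<^sub>M unit_lborel)"
  proof -
    have "(\<lambda>z. (fst z, snd z)) \<in> measurable (unit_lborel \<Otimes>\<^sub>M unit_lborel) (borel \<Otimes>\<^sub>M borel)"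
      by (intro measurable_Pair measurable_compose[OF measurable_fst] measurable_compose[OF measurable_snd]
        measurable_restrict_space1) auto
    from measurable_sets[OF this sets.compl_sets[OF Nm]] show ?thesis
      by (simp add: vimage_def space_pair_measure Int_def conj_commute)
  qed
  ultimately have "AE z in unit_lborel \<Otimes>\<^sub>M unit_lborel. z \<notin> N"
    by (intro unit_lborel2.AE_pair_measure) auto
  then show ?thesis by eventually_elim (use N in auto)
qed

lemma borel_measurable_unit_square [measurable (raw)]:
  assumes "f \<in> borel_measurable borel"
  shows "f \<in> borel_measurable (unit_lborel \<Otimes>\<^sub>M unit_lborel)"
proof -
  have "(\<lambda>z. (fst z, snd z)) \<in> measurable (unit_lborel \<Otimes>\<^sub>M unit_lborel) (borel \<Otimes>\<^sub>M borel)"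
    by (intro measurable_Pair measurable_compose[OF measurable_fst] measurable_compose[OF measurable_snd]
      measurable_restrict_space1) auto
  from measurable_compose[OF this, of f borel] assms show ?thesis
    by (simp add: borel_prod)
qed

text \<open>The Borel version of the sets in \<open>independence_ratio\<close>, placed on a
  probability space; a clique of \<open>W\<close> is an independent set of
  \<open>1 - W\<close>.\<close>

definition independent_set :: "(real \<times> real \<Rightarrow> real) \<Rightarrow> real set \<Rightarrow> bool" where
  "independent_set W S \<longleftrightarrow> S \<in> sets unit_lborel \<and>
     (AE z in unit_lborel \<Otimes>\<^sub>M unit_lborel. z \<in> S \<times> S \<longrightarrow> W z = 0)"

text \<open>\<open>main_part\<close> is a Borel subset that loses only a null set, and independence
  passes to subsets.\<close>

lemma independent_set_of_lebesgue:
  assumes "S \<in> sets lebesgue" "S \<subseteq> {0..1}" and ae: "AE z in lebesgue. z \<in> S \<times> S \<longrightarrow> W z = 0"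
  obtains S' where "independent_set W S'" "measure unit_lborel S' = measure lebesgue S"
proof
  have sub: "main_part lborel S \<subseteq> S" using main_part_null_part_Un[of S lborel] assms(1) by blast
  have bo: "main_part lborel S \<in> sets borel" using main_part_sets[of S lborel] assms(1) by simp
  show "measure unit_lborel (main_part lborel S) = measure lebesgue S"
    using sub assms by (subst measure_unit_lborel) (auto simp: measure_def)
  have "AE z in lborel. z \<in> main_part lborel S \<times> main_part lborel S \<longrightarrow> W z = 0"
    using ae unfolding AE_completion_iff by eventually_elim (use sub in auto)
  then show "independent_set W (main_part lborel S)"
    using sub bo assms(2) by (auto simp: independent_set_def sets_unit_lborel intro: AE_unit_square)
qed

lemma independence_ratio_approx:
  assumes "r < independence_ratio W"
  obtains S where "independent_set W S" "r < measure unit_lborel S"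
proof -
  have "\<exists>s\<in>{measure lebesgue S | S. S \<in> sets lebesgue \<and> S \<subseteq> {0..1} \<and>
            (AE z in lebesgue. z \<in> S \<times> S \<longrightarrow> W z = 0)}. r < s"
  proof (rule less_cSupE)
    show "r < Sup {measure lebesgue S | S. S \<in> sets lebesgue \<and> S \<subseteq> {0..1} \<and>
            (AE z in lebesgue. z \<in> S \<times> S \<longrightarrow> W z = 0)}"
      using assms by (simp add: independence_ratio_def)
    show "{measure lebesgue S | S. S \<in> sets lebesgue \<and> S \<subseteq> {0..1} \<and>
            (AE z in lebesgue. z \<in> S \<times> S \<longrightarrow> W z = 0)} \<noteq> {}"
      by (auto intro!: exI[of _ "{}"])
  qed auto
  then obtain S where S: "S \<in> sets lebesgue" "S \<subseteq> {0..1}"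
      "AE z in lebesgue. z \<in> S \<times> S \<longrightarrow> W z = 0" "r < measure lebesgue S"
    by auto
  from independent_set_of_lebesgue[OF S(1-3)] obtain S' where
    "independent_set W S'" "measure unit_lborel S' = measure lebesgue S" .
  with S that show thesis by auto
qed

lemma measure_unit_square_Times:
  assumes "S \<in> sets unit_lborel" "T \<in> sets unit_lborel"
  shows "measure (unit_lborel \<Otimes>\<^sub>M unit_lborel) (S \<times> T) = measure unit_lborel S * measure unit_lborel T"
  using unit_lborel.emeasure_pair_measure_Times[OF assms]
  by (simp add: measure_def enn2real_mult)

text \<open>On the square of the intersection \<open>W\<close> would be both 0 and 1 a.e., so this
  square is null, and its measure is the square of that of the intersection.\<close>

lemma null_independent_Int_clique:
  assumes S: "independent_set W S" and T: "independent_set (\<lambda>z. 1 - W z) T"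
  shows "S \<inter> T \<in> null_sets unit_lborel"
proof -
  have m: "S \<inter> T \<in> sets unit_lborel"
    using S T by (auto simp: independent_set_def)
  have "AE z in unit_lborel \<Otimes>\<^sub>M unit_lborel. z \<notin> (S \<inter> T) \<times> (S \<inter> T)"
    using S[unfolded independent_set_def, THEN conjunct2] T[unfolded independent_set_def, THEN conjunct2]
    by eventually_elim auto
  then have "measure (unit_lborel \<Otimes>\<^sub>M unit_lborel) ((S \<inter> T) \<times> (S \<inter> T)) = 0"
    using m by (intro measure_eq_0_null_sets) (simp add: AE_iff_null_sets)
  then have "measure unit_lborel (S \<inter> T) = 0"
    using measure_unit_square_Times[OF m m] by simp
  with m show ?thesis
    by (simp add: null_sets_def unit_lborel.emeasure_eq_measure)
qed

lemma measure_independent_clique_le: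
  assumes S: "independent_set W S" and T: "independent_set (\<lambda>z. 1 - W z) T"
  shows "measure unit_lborel S + measure unit_lborel T \<le> 1"
proof -
  have "measure unit_lborel (S \<inter> T) = 0"
    using null_independent_Int_clique[OF assms] by (rule measure_eq_0_null_sets)
  then have "measure unit_lborel S + measure unit_lborel T = measure unit_lborel (S \<union> T)"
    using S T unit_lborel.finite_measure_Union'[of S T] unit_lborel.finite_measure_Diff'[of T S]
    by (simp add: independent_set_def Int_commute)
  then show ?thesis by simp
qed

text \<open>The two sets certify each other: \<open>T\<close> is a clique of \<open>W\<close>, so
  every independent set has measure at most \<open>1 - (1 - s)\<close>, and \<open>S\<close> attains
  this. The same holds with the roles exchanged.\<close>

lemma independence_ratio_eqI:
  assumes W: "W = (\<lambda>z. 1 - V z)"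
    and S: "S \<in> sets borel" "S \<subseteq> {0..1}" "\<And>z. z \<in> S \<times> S \<Longrightarrow> W z = 0"
    and T: "T \<in> sets borel" "T \<subseteq> {0..1}" "\<And>z. z \<in> T \<times> T \<Longrightarrow> V z = 0"
    and s: "measure lborel S = s" "measure lborel T = 1 - s"
  shows "independence_ratio W = s" "independence_ratio V = 1 - s"
proof -
  have iS: "independent_set W S" using S by (auto simp: independent_set_def sets_unit_lborel)
  have iT: "independent_set V T" using T by (auto simp: independent_set_def sets_unit_lborel)
  have V: "V = (\<lambda>z. 1 - W z)" using W by auto
  show "independence_ratio W = s"
    unfolding independence_ratio_def
  proof (rule cSup_eq_maximum)
    show "s \<in> {measure lebesgue S |S. S \<in> sets lebesgue \<and> S \<subseteq> {0..1} \<and>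
        (AE z in lebesgue. z \<in> S \<times> S \<longrightarrow> W z = 0)}"
      using S s by (intro CollectI exI[of _ S]) auto
    fix x assume "x \<in> {measure lebesgue S |S. S \<in> sets lebesgue \<and> S \<subseteq> {0..1} \<and>
        (AE z in lebesgue. z \<in> S \<times> S \<longrightarrow> W z = 0)}"
    then obtain S' where S': "independent_set W S'" "x = measure unit_lborel S'"
      by (auto elim!: independent_set_of_lebesgue)
    show "x \<le> s"
      using measure_independent_clique_le[OF S'(1) iT[unfolded V]] S' T s measure_unit_lborel[of T] by simp
  qed
  show "independence_ratio V = 1 - s"
    unfolding independence_ratio_def
  proof (rule cSup_eq_maximum)
    show "1 - s \<in> {measure lebesgue S |S. S \<in> sets lebesgue \<and> S \<subseteq> {0..1} \<and>
        (AE z in lebesgue. z \<in> S \<times> S \<longrightarrow> V z = 0)}"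
      using T s by (intro CollectI exI[of _ T]) auto
    fix x assume "x \<in> {measure lebesgue S |S. S \<in> sets lebesgue \<and> S \<subseteq> {0..1} \<and>
        (AE z in lebesgue. z \<in> S \<times> S \<longrightarrow> V z = 0)}"
    then obtain T' where T': "independent_set V T'" "x = measure unit_lborel T'"
      by (auto elim!: independent_set_of_lebesgue)
    show "x \<le> 1 - s"
      using measure_independent_clique_le[OF iS T'(1)[unfolded V]] T' S s measure_unit_lborel[of S] by simp
  qed
qed

lemma ratios_step_graphon:
  assumes "a \<in> {0..1}"
  shows "independence_ratio (step_graphon a p) = a" "clique_ratio (step_graphon a p) = 1 - a"
proof -
  have "step_graphon a p z = 0" if "z \<in> {0..<a} \<times> {0..<a}" for z
    using that by (simp add: step_graphon_def)
  moreover have "1 - step_graphon a p z = 0" if "z \<in> {a..1} \<times> {a..1}" for z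
    using that by (auto simp: step_graphon_def)
  ultimately show "independence_ratio (step_graphon a p) = a" "clique_ratio (step_graphon a p) = 1 - a"
    unfolding clique_ratio_def using assms
    by (auto intro!: independence_ratio_eqI[of "step_graphon a p" "\<lambda>z. 1 - step_graphon a p z" "{0..<a}" "{a..1}" a])
qed

text \<open>
  As the measures converge, \<open>S \<times> S\<close> is exhausted up to a null set by the squares \<open>S n \<times> S n\<close>.
\<close>

lemma independent_set_UN:
  assumes S: "\<And>n. independent_set W (S n)"
    and lim: "(\<lambda>n. measure unit_lborel (S n)) \<longlonglongrightarrow> measure unit_lborel (\<Union>n. S n)"
  shows "independent_set W (\<Union>n::nat. S n)"
proof -
  let ?S = "\<Union>n. S n" and ?Q = "\<Union>n. S n \<times> S n" and ?M = "unit_lborel \<Otimes>\<^sub>M unit_lborel"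
  have Sm [measurable]: "S n \<in> sets unit_lborel" for n using S by (auto simp: independent_set_def)
  have Qm: "?Q \<in> sets ?M" and Um: "?S \<in> sets unit_lborel" by measurable
  have "(\<lambda>n. measure ?M (S n \<times> S n)) \<longlonglongrightarrow> measure ?M (?S \<times> ?S)"
    using tendsto_mult[OF lim lim] by (simp add: measure_unit_square_Times[OF Sm Sm] measure_unit_square_Times[OF Um Um])
  moreover have "measure ?M (S n \<times> S n) \<le> measure ?M ?Q" for n
    using Qm by (intro unit_lborel2.finite_measure_mono) auto
  ultimately have "measure ?M (?S \<times> ?S) \<le> measure ?M ?Q"
    by (intro LIMSEQ_le_const2) auto
  then have "measure ?M (?S \<times> ?S - ?Q) = 0"
    using Qm Um by (subst unit_lborel2.finite_measure_Diff)
      (auto intro!: antisym unit_lborel2.finite_measure_mono)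
  then have "?S \<times> ?S - ?Q \<in> null_sets ?M"
    using Qm Um by (auto simp: null_sets_def unit_lborel2.emeasure_eq_measure)
  then have "AE z in ?M. z \<notin> ?S \<times> ?S - ?Q" by (rule AE_not_in)
  moreover have "AE z in ?M. \<forall>n. z \<in> S n \<times> S n \<longrightarrow> W z = 0"
    using S by (intro AE_all_countable[THEN iffD2] allI) (simp add: independent_set_def)
  ultimately have "AE z in ?M. z \<in> ?S \<times> ?S \<longrightarrow> W z = 0"
    by eventually_elim auto
  with Um show ?thesis by (simp add: independent_set_def)
qed

lemma independent_set_cong:
  assumes S: "independent_set W S" and T: "T \<in> sets unit_lborel"
    and eq: "AE x in unit_lborel. x \<in> S \<longleftrightarrow> x \<in> T"
  shows "independent_set W T"
proof -
  obtain N where N: "N \<in> null_sets unit_lborel" "{x \<in> space unit_lborel. \<not> (x \<in> S \<longleftrightarrow> x \<in> T)} \<subseteq> N"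
    using eq by (auto simp: eventually_ae_filter)
  have "AE z in unit_lborel \<Otimes>\<^sub>M unit_lborel. z \<notin> N \<times> space unit_lborel"
    "AE z in unit_lborel \<Otimes>\<^sub>M unit_lborel. z \<notin> space unit_lborel \<times> N"
    by (intro AE_not_in unit_lborel.times_in_null_sets1 N sets.top)
      (intro AE_not_in unit_lborel.times_in_null_sets2 N sets.top)
  moreover have "AE z in unit_lborel \<Otimes>\<^sub>M unit_lborel. z \<in> S \<times> S \<longrightarrow> W z = 0"
    using S by (simp add: independent_set_def)
  moreover have "AE z in unit_lborel \<Otimes>\<^sub>M unit_lborel. z \<in> space unit_lborel \<times> space unit_lborel"
    by (intro AE_I2) (simp add: space_pair_measure)
  ultimately have "AE z in unit_lborel \<Otimes>\<^sub>M unit_lborel. z \<in> T \<times> T \<longrightarrow> W z = 0"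
    by eventually_elim (use N(2) in auto)
  with T show ?thesis by (simp add: independent_set_def)
qed

text \<open>The unions \<open>SS\<close> and \<open>TT\<close> have measures at least
  \<open>a\<close> and \<open>1 - a\<close> and meet in a null set, so both bounds are equalities.
  Hence the measures of the approximating sets converge to those of the unions, as
  \<open>independent_set_UN\<close> requires. Finally \<open>TT\<close> is exchanged for the
  complement of \<open>SS\<close>, from which it differs by a null set.\<close>

lemma ex_independent_clique_partition:
  assumes \<alpha>: "independence_ratio U = a" and \<omega>: "clique_ratio U = 1 - a"
  obtains S where "measure unit_lborel S = a" "independent_set U S"
    "independent_set (\<lambda>z. 1 - U z) ({0..1} - S)"
proof -
  let ?U' = "\<lambda>z. 1 - U z"
  have "\<exists>S. independent_set U S \<and> a - inverse (real (Suc n)) < measure unit_lborel S" for n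
    using independence_ratio_approx[of "a - inverse (real (Suc n))" U] \<alpha> by auto
  then obtain S where S: "\<And>n. independent_set U (S n)"
      "\<And>n. a - inverse (real (Suc n)) < measure unit_lborel (S n)"
    by metis
  have "\<exists>T. independent_set ?U' T \<and> 1 - a - inverse (real (Suc n)) < measure unit_lborel T" for n
    using independence_ratio_approx[of "1 - a - inverse (real (Suc n))" ?U'] \<omega> by (auto simp: clique_ratio_def)
  then obtain T where T: "\<And>n. independent_set ?U' (T n)"
      "\<And>n. 1 - a - inverse (real (Suc n)) < measure unit_lborel (T n)"
    by metis
  have Sm [measurable]: "S n \<in> sets unit_lborel" and Tm [measurable]: "T n \<in> sets unit_lborel" for n
    using S T by (auto simp: independent_set_def)
  define SS where "SS = (\<Union>n. S n)"
  define TT where "TT = (\<Union>n. T n)"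
  have SSm [measurable]: "SS \<in> sets unit_lborel" and TTm [measurable]: "TT \<in> sets unit_lborel"
    unfolding SS_def TT_def by measurable
  have "SS \<inter> TT = (\<Union>m. \<Union>n. S m \<inter> T n)" by (auto simp: SS_def TT_def)
  also have "\<dots> \<in> null_sets unit_lborel"
    using S(1) T(1) by (intro null_sets_UN null_independent_Int_clique)
  finally have null: "SS \<inter> TT \<in> null_sets unit_lborel" .
  then have null': "measure unit_lborel (SS \<inter> TT) = 0" by (rule measure_eq_0_null_sets)
  have un: "measure unit_lborel (SS \<union> TT) = measure unit_lborel SS + measure unit_lborel TT"
    using unit_lborel.finite_measure_Union'[of SS TT] unit_lborel.finite_measure_Diff'[of TT SS] null'
    by (simp add: Int_commute)
  have S_le: "measure unit_lborel (S n) \<le> measure unit_lborel SS" for n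
    by (intro unit_lborel.finite_measure_mono) (auto simp: SS_def)
  have T_le: "measure unit_lborel (T n) \<le> measure unit_lborel TT" for n
    by (intro unit_lborel.finite_measure_mono) (auto simp: TT_def)
  have inv: "(\<lambda>n. c - inverse (real (Suc n))) \<longlonglongrightarrow> c" for c :: real
    using tendsto_diff[OF tendsto_const LIMSEQ_inverse_real_of_nat, of c] by simp
  have "a \<le> measure unit_lborel SS"
    by (rule LIMSEQ_le_const2[OF inv]) (use less_imp_le[OF less_le_trans[OF S(2) S_le]] in \<open>auto intro!: exI[of _ 0]\<close>)
  moreover have "1 - a \<le> measure unit_lborel TT"
    by (rule LIMSEQ_le_const2[OF inv]) (use less_imp_le[OF less_le_trans[OF T(2) T_le]] in \<open>auto intro!: exI[of _ 0]\<close>)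
  moreover have "measure unit_lborel (SS \<union> TT) \<le> 1" by simp
  ultimately have mS: "measure unit_lborel SS = a" and mT: "measure unit_lborel TT = 1 - a"
      and mU: "measure unit_lborel (SS \<union> TT) = 1"
    using un by linarith+
  have "(\<lambda>n. measure unit_lborel (S n)) \<longlonglongrightarrow> measure unit_lborel SS"
    unfolding mS using S(2) S_le mS
    by (intro tendsto_sandwich[OF _ _ inv[of a] tendsto_const]) (auto intro!: always_eventually less_imp_le)
  then have iS: "independent_set U SS"
    unfolding SS_def by (intro independent_set_UN S)
  have "(\<lambda>n. measure unit_lborel (T n)) \<longlonglongrightarrow> measure unit_lborel TT"
    unfolding mT using T(2) T_le mT
    by (intro tendsto_sandwich[OF _ _ inv[of "1 - a"] tendsto_const]) (auto intro!: always_eventually less_imp_le)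
  then have iT: "independent_set ?U' TT"
    unfolding TT_def by (intro independent_set_UN T)
  have "AE x in unit_lborel. x \<in> SS \<union> TT"
    using mU by (intro unit_lborel.AE_prob_1) 
  moreover have "AE x in unit_lborel. x \<notin> SS \<inter> TT" using null by (rule AE_not_in)
  moreover have "AE x in unit_lborel. x \<in> {0..1}" by (intro AE_I2) (simp add: space_unit_lborel)
  ultimately have "AE x in unit_lborel. x \<in> TT \<longleftrightarrow> x \<in> {0..1} - SS"
    by eventually_elim auto
  then have "independent_set ?U' ({0..1} - SS)"
    by (intro independent_set_cong[OF iT]) (use sets.compl_sets[OF SSm] in \<open>auto simp: space_unit_lborel\<close>)
  with iS mS that show thesis by blast
qed

text \<open>\<open>v\<close> is read on one crossing block and transposed onto the other, so
  symmetry and the block values hold everywhere and for every \<open>v\<close>. This suits the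
  pointwise assumptions of \<open>cross_kernel\<close>.\<close>

definition split_graphon :: "real set \<Rightarrow> (real \<times> real \<Rightarrow> real) \<Rightarrow> real \<times> real \<Rightarrow> real" where
  "split_graphon S v = (\<lambda>(x, y). if x \<in> S then if y \<in> S then 0 else v (x, y)
     else if y \<in> S then v (y, x) else 1)"

text \<open>The two formulas agree at every point of the unit square but can differ outside
  it.\<close>

lemma step_graphon_eq_split_graphon:
  "AE z in unit_lborel \<Otimes>\<^sub>M unit_lborel. step_graphon a p z = split_graphon {0..<a} (\<lambda>_. p) z"
  by (intro AE_I2, unfold step_graphon_def split_graphon_def)
    (simp add: space_pair_measure space_unit_lborel split: prod.split, auto)

lemma AE_unit_square_swap:
  assumes "AE z in unit_lborel \<Otimes>\<^sub>M unit_lborel. P z"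
  shows "AE z in unit_lborel \<Otimes>\<^sub>M unit_lborel. P (prod.swap z)"
proof -
  have "AE z in unit_lborel \<Otimes>\<^sub>M unit_lborel. P ((\<lambda>(x, y). (y, x)) z)"
    by (rule AE_distrD[OF measurable_pair_swap'])
       (subst unit_lborel2.distr_pair_swap[symmetric], rule assms)
  then show ?thesis by (simp add: prod.swap_def case_prod_beta')
qed

lemma ex_split_graphon:
  assumes U: "graphon U" and S: "independent_set U S" "independent_set (\<lambda>z. 1 - U z) ({0..1} - S)"
  obtains v where "v \<in> borel_measurable borel" "\<And>z. v z \<in> {0..1}"
    "AE z in unit_lborel \<Otimes>\<^sub>M unit_lborel. U z = split_graphon S v z"
proof -
  let ?Q = "{0..1} \<times> {0..1} :: (real \<times> real) set"
  have Q: "?Q \<in> sets lebesgue"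
    by (intro sets_completionI_sets) (simp add: borel_closed closed_Times)
  have "(\<lambda>z. if z \<in> ?Q then U z else 0) \<in> borel_measurable lebesgue"
    using U Q measurable_restrict_space_iff[of ?Q lebesgue 0 borel U] by (simp add: graphon_def)
  from completion_ex_borel_measurable_real[OF this] obtain u where
    u: "u \<in> borel_measurable borel" "AE z in lborel. (if z \<in> ?Q then U z else 0) = u z"
    by auto
  \<comment> \<open>Clamping yields the range at every point and leaves \<open>u\<close> unchanged
    wherever it equals a value of \<open>U\<close> on the square.\<close>
  define v where "v z = min 1 (max 0 (u z))" for z
  have "AE z in unit_lborel \<Otimes>\<^sub>M unit_lborel. z \<in> ?Q"
    by (intro AE_I2) (auto simp: space_pair_measure space_unit_lborel)
  moreover from AE_unit_square[OF u(2)]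
  have "AE z in unit_lborel \<Otimes>\<^sub>M unit_lborel. (if z \<in> ?Q then U z else 0) = u z" .
  ultimately have eq: "AE z in unit_lborel \<Otimes>\<^sub>M unit_lborel. z \<in> ?Q \<and> U z = v z"
  proof eventually_elim
    case (elim z)
    then have "u z = U z" by auto
    moreover have "U z \<in> {0..1}" using U elim(1) by (auto simp: graphon_def)
    ultimately show ?case using elim(1) by (simp add: v_def)
  qed
  have "AE z in unit_lborel \<Otimes>\<^sub>M unit_lborel. U z = split_graphon S v z"
    \<comment> \<open>With the first coordinate outside \<open>S\<close> and the second inside,
      \<open>split_graphon\<close> evaluates \<open>v\<close> at the swapped point, so the equality
      is needed there too.\<close>
    using eq AE_unit_square_swap[OF eq] S(1)[unfolded independent_set_def, THEN conjunct2]
      S(2)[unfolded independent_set_def, THEN conjunct2]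
  proof eventually_elim
    case (elim z)
    moreover have "U (prod.swap z) = U z" using U elim by (auto simp: graphon_def)
    ultimately show ?case by (cases z) (auto simp: split_graphon_def)
  qed
  moreover have "v \<in> borel_measurable borel" unfolding v_def using u(1) by measurable
  moreover have "v z \<in> {0..1}" for z by (simp add: v_def)
  ultimately show thesis using that by blast
qed

section \<open>Perturbations of the step kernel\<close>

lemma abs_mult_le_1: "\<bar>a\<bar> \<le> 1 \<Longrightarrow> \<bar>b\<bar> \<le> 1 \<Longrightarrow> \<bar>a * b\<bar> \<le> (1 :: real)"
  by (simp add: abs_mult mult_le_one)

lemma (in prob_space) integrable_bounded:
  fixes f :: "'a \<Rightarrow> real"
  assumes "f \<in> borel_measurable M" "\<And>x. \<bar>f x\<bar> \<le> B"
  shows "integrable M f"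
  using assms by (intro integrable_const_bound[where B = B]) auto

lemma (in prob_space) abs_integral_le:
  fixes f :: "'a \<Rightarrow> real"
  assumes "f \<in> borel_measurable M" "\<And>x. \<bar>f x\<bar> \<le> B"
  shows "\<bar>\<integral>x. f x \<partial>M\<bar> \<le> B"
proof -
  have "\<bar>\<integral>x. f x \<partial>M\<bar> \<le> (\<integral>x. \<bar>f x\<bar> \<partial>M)" by (rule integral_abs_bound)
  also have "\<dots> \<le> B"
    using assms by (intro integral_le_const integrable_abs integrable_bounded[where B = B]) auto
  finally show ?thesis .
qed

text \<open>The second and third conclusions restore the hypotheses for the inner integral, so that
  coordinates can be split off one at a time.\<close>

lemma (in prob_space) integral_PiM_insert_bounded:
  fixes f :: "('i \<Rightarrow> 'a) \<Rightarrow> real"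
  assumes I: "finite I" "i \<notin> I"
    and f[measurable]: "f \<in> borel_measurable (PiM (insert i I) (\<lambda>_. M))"
    and B: "\<And>x. \<bar>f x\<bar> \<le> B"
  shows "(\<integral>x. f x \<partial>PiM (insert i I) (\<lambda>_. M)) = (\<integral>x. (\<integral>y. f (x(i := y)) \<partial>M) \<partial>PiM I (\<lambda>_. M))"
    and "(\<lambda>x. \<integral>y. f (x(i := y)) \<partial>M) \<in> borel_measurable (PiM I (\<lambda>_. M))"
    and "\<bar>\<integral>y. f (x(i := y)) \<partial>M\<bar> \<le> B"
proof -
  interpret P: product_prob_space "\<lambda>_. M" ..
  interpret Pi: prob_space "PiM (insert i I) (\<lambda>_. M)"
    by (intro prob_space_PiM prob_space_axioms)
  show "(\<integral>x. f x \<partial>PiM (insert i I) (\<lambda>_. M)) = (\<integral>x. (\<integral>y. f (x(i := y)) \<partial>M) \<partial>PiM I (\<lambda>_. M))"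
    by (rule P.product_integral_insert[OF I Pi.integrable_bounded[OF f B]])
  have "(\<lambda>(x, y). f (x(i := y))) \<in> borel_measurable (PiM I (\<lambda>_. M) \<Otimes>\<^sub>M M)"
    using measurable_compose[OF measurable_add_dim f] by (simp add: case_prod_beta')
  then show "(\<lambda>x. \<integral>y. f (x(i := y)) \<partial>M) \<in> borel_measurable (PiM I (\<lambda>_. M))"
    by (rule borel_measurable_lebesgue_integral)
  show "\<bar>\<integral>y. f (x(i := y)) \<partial>M\<bar> \<le> B"
  proof (cases "(\<lambda>y. f (x(i := y))) \<in> borel_measurable M")
    case True
    then show ?thesis by (rule abs_integral_le[OF _ B])
  next
    \<comment> \<open>For \<open>x\<close> outside the product space the section may fail to be
      measurable; its integral is then 0 by convention.\<close>
    case False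
    then have "\<not> integrable M (\<lambda>y. f (x(i := y)))" by auto
    then show ?thesis using order_trans[OF abs_ge_zero B] by (simp add: not_integrable_integral_eq)
  qed
qed

lemma (in prob_space) integral_PiM_four:
  fixes f :: "('i \<Rightarrow> 'a) \<Rightarrow> real"
  assumes dist: "distinct [i, j, k, l]"
    and f: "f \<in> borel_measurable (PiM {i, j, k, l} (\<lambda>_. M))"
    and B: "\<And>x. \<bar>f x\<bar> \<le> B"
  shows "(\<integral>x. f x \<partial>PiM {i, j, k, l} (\<lambda>_. M)) =
    (\<integral>a. \<integral>b. \<integral>c. \<integral>d. f ((\<lambda>_. undefined)(i := a, j := b, k := c, l := d)) \<partial>M \<partial>M \<partial>M \<partial>M)"
proof -
  have eq: "{i, j, k, l} = insert l {i, j, k}" "{i, j, k} = insert k {i, j}" "{i, j} = insert j {i}"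
    by auto
  have I: "finite {i, j, k}" "l \<notin> {i, j, k}" "finite {i, j}" "k \<notin> {i, j}" "finite {i}" "j \<notin> {i}" "i \<notin> {}"
    using dist by auto
  note 1 = integral_PiM_insert_bounded[OF I(1,2) f[unfolded eq(1)] B]
  note 2 = integral_PiM_insert_bounded[OF I(3,4) 1(2)[unfolded eq(2)] 1(3)]
  note 3 = integral_PiM_insert_bounded[OF I(5,6) 2(2)[unfolded eq(3)] 2(3)]
  note 4 = integral_PiM_insert_bounded[OF finite.emptyI I(7) 3(2) 3(3)]
  show ?thesis
    unfolding eq(1) 1(1) unfolding eq(2) 2(1) unfolding eq(3) 3(1) 4(1)
    by (simp add: PiM_empty lebesgue_integral_count_space_finite fun_upd_def)
qed

text \<open>
  Here \<open>base\<close> and \<open>kernel\<close> are \<open>W - p\<close> and \<open>U - p\<close> for the step graphon \<open>W\<close> and a graphon \<open>U\<close>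
  with independent set \<open>S\<close> and complementary clique, and \<open>g = U - W\<close>.
\<close>

locale cross_kernel = prob_space M
  for M :: "'a measure" +
  fixes S :: "'a set" and g :: "'a \<times> 'a \<Rightarrow> real" and p :: real
  assumes S [measurable]: "S \<in> sets M"
    and g [measurable]: "g \<in> borel_measurable (M \<Otimes>\<^sub>M M)"
    and g_bound: "\<bar>g z\<bar> \<le> 1"
    and g_sym: "g (x, y) = g (y, x)"
    and g_zero: "(x \<in> S) = (y \<in> S) \<Longrightarrow> g (x, y) = 0"
    and p: "p \<in> {0..1}"
begin

sublocale MM: pair_prob_space M M ..

definition base :: "'a \<times> 'a \<Rightarrow> real" where
  "base z = (if fst z \<in> S then if snd z \<in> S then - p else 0 else if snd z \<in> S then 0 else 1 - p)"

definition kernel :: "'a \<times> 'a \<Rightarrow> real" where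
  "kernel z = base z + g z"

definition base_degree :: "'a \<Rightarrow> real" where
  "base_degree x = (if x \<in> S then - p * prob S else (1 - p) * (1 - prob S))"

text \<open>The function \<open>G\<close> of the overview: the amount by which the degree in
  \<open>U\<close> exceeds that in \<open>W\<close>.\<close>

definition excess :: "'a \<Rightarrow> real" where
  "excess x = (\<integral>y. g (x, y) \<partial>M)"

text \<open>The kernel of the square of the integral operator of \<open>g\<close>; the integral of
  \<open>codegree\<close> squared is the density of the 4-cycle in \<open>g\<close>.\<close>

definition codegree :: "'a \<Rightarrow> 'a \<Rightarrow> real" where
  "codegree x y = (\<integral>z. g (x, z) * g (y, z) \<partial>M)"

lemma base_measurable [measurable]: "base \<in> borel_measurable (M \<Otimes>\<^sub>M M)"
  unfolding base_def by measurable

lemma kernel_measurable [measurable]: "kernel \<in> borel_measurable (M \<Otimes>\<^sub>M M)"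
  unfolding kernel_def by measurable

lemma base_degree_measurable [measurable]: "base_degree \<in> borel_measurable M"
  unfolding base_degree_def by measurable

lemma excess_measurable [measurable]: "excess \<in> borel_measurable M"
  unfolding excess_def by measurable

lemma codegree_measurable [measurable]: "(\<lambda>(x, y). codegree x y) \<in> borel_measurable (M \<Otimes>\<^sub>M M)"
  unfolding codegree_def by measurable

lemma base_bound: "\<bar>base z\<bar> \<le> 1"
  using p by (auto simp: base_def)

lemma base_sym: "base (x, y) = base (y, x)"
  by (auto simp: base_def)

lemma kernel_sym: "kernel (x, y) = kernel (y, x)"
  by (simp add: kernel_def base_sym[of x] g_sym[of x])

text \<open>The two bounds do not add up, because \<open>base\<close> vanishes across the parts and
  \<open>g\<close> inside them.\<close>

lemma kernel_bound: "\<bar>kernel z\<bar> \<le> 1"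
  using base_bound[of z] g_bound[of z] g_zero[of "fst z" "snd z"] by (auto simp: kernel_def base_def)

lemma base_degree_bound: "\<bar>base_degree x\<bar> \<le> 1"
  using p by (auto simp: base_degree_def abs_mult intro!: mult_le_one)

lemma g_integrable: "x \<in> space M \<Longrightarrow> integrable M (\<lambda>y. g (x, y))"
  by (rule integrable_bounded[OF _ g_bound]) measurable

lemma base_integrable: "x \<in> space M \<Longrightarrow> integrable M (\<lambda>y. base (x, y))"
  by (rule integrable_bounded[OF _ base_bound]) measurable

lemma excess_bound: "\<bar>excess x\<bar> \<le> 1"
proof (cases "(\<lambda>y. g (x, y)) \<in> borel_measurable M")
  case True
  then show ?thesis unfolding excess_def by (rule abs_integral_le[OF _ g_bound])
next
  case False
  then have "\<not> integrable M (\<lambda>y. g (x, y))" by auto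
  then show ?thesis by (simp add: excess_def not_integrable_integral_eq)
qed

lemma integral_indicator_S: "(\<integral>x. u * indicator S x + w * (1 - indicator S x) \<partial>M) = u * prob S + w * (1 - prob S)"
proof -
  have "integrable M (indicator S :: 'a \<Rightarrow> real)"
    by (rule integrable_real_indicator) (auto simp: emeasure_eq_measure)
  then show ?thesis by (simp add: prob_space)
qed

lemma integral_base: "(\<integral>y. base (x, y) \<partial>M) = base_degree x"
proof (cases "x \<in> S")
  case True
  then have "(\<integral>y. base (x, y) \<partial>M) = (\<integral>y. - p * indicator S y + 0 * (1 - indicator S y) \<partial>M)"
    by (intro Bochner_Integration.integral_cong) (auto simp: base_def)
  with True show ?thesis unfolding integral_indicator_S by (simp add: base_degree_def)
next
  case False
  then have "(\<integral>y. base (x, y) \<partial>M) = (\<integral>y. 0 * indicator S y + (1 - p) * (1 - indicator S y) \<partial>M)"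
    by (intro Bochner_Integration.integral_cong) (auto simp: base_def)
  with False show ?thesis unfolding integral_indicator_S by (simp add: base_degree_def)
qed

lemma integral_kernel: "x \<in> space M \<Longrightarrow> (\<integral>y. kernel (x, y) \<partial>M) = base_degree x + excess x"
  unfolding kernel_def by (simp add: integral_base excess_def g_integrable base_integrable)

lemma integral_base_degree_power:
  assumes "m > 0"
  shows "(\<integral>x. base_degree x ^ m \<partial>M) =
    prob S * (- p * prob S) ^ m + (1 - prob S) * ((1 - p) * (1 - prob S)) ^ m"
proof -
  have "(\<integral>x. base_degree x ^ m \<partial>M) = (\<integral>x. (- p * prob S) ^ m * indicator S x +
      ((1 - p) * (1 - prob S)) ^ m * (1 - indicator S x) \<partial>M)"
    by (intro Bochner_Integration.integral_cong) (auto simp: base_degree_def)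
  then show ?thesis unfolding integral_indicator_S by (simp add: mult.commute)
qed

lemma integral_kernel_mean:
  "(\<integral>x. \<integral>y. kernel (x, y) \<partial>M \<partial>M) =
    - p * prob S ^ 2 + (1 - p) * (1 - prob S) ^ 2 + (\<integral>x. excess x \<partial>M)"
proof -
  have "(\<integral>x. \<integral>y. kernel (x, y) \<partial>M \<partial>M) = (\<integral>x. base_degree x + excess x \<partial>M)"
    by (intro Bochner_Integration.integral_cong) (simp_all add: integral_kernel)
  also have "\<dots> = (\<integral>x. base_degree x ^ 1 \<partial>M) + (\<integral>x. excess x \<partial>M)"
    by (simp add: Bochner_Integration.integral_add integrable_bounded[OF _ base_degree_bound] integrable_bounded[OF _ excess_bound])
  finally show ?thesis
    using integral_base_degree_power[of 1] by (simp add: power2_eq_square)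
qed

text \<open>\<open>g\<close> lives on pairs with exactly one point in \<open>S\<close>, and by
  symmetry the two orders contribute equally.\<close>

lemma integral_indicator_excess: "2 * (\<integral>x. indicator S x * excess x \<partial>M) = (\<integral>x. excess x \<partial>M)"
proof -
  have b: "\<bar>indicator S (f z) * g z\<bar> \<le> 1" for z and f :: "'a \<times> 'a \<Rightarrow> 'a"
    using g_bound[of z] by (auto simp: indicator_def)
  have i1: "integrable (M \<Otimes>\<^sub>M M) (\<lambda>z. indicator S (fst z) * g z)"
    by (rule MM.P.integrable_bounded[OF _ b]) measurable
  have i2: "integrable (M \<Otimes>\<^sub>M M) (\<lambda>z. indicator S (snd z) * g z)"
    by (rule MM.P.integrable_bounded[OF _ b]) measurable
  have e1: "(\<integral>x. indicator S x * excess x \<partial>M) = (\<integral>z. indicator S (fst z) * g z \<partial>(M \<Otimes>\<^sub>M M))"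
    using MM.integral_fst[of "\<lambda>x y. indicator S x * g (x, y)"] i1 by (simp add: excess_def case_prod_beta')
  have "(\<integral>z. indicator S (snd z) * g z \<partial>(M \<Otimes>\<^sub>M M)) = (\<integral>y. \<integral>x. indicator S y * g (x, y) \<partial>M \<partial>M)"
    using MM.integral_snd[of "\<lambda>x y. indicator S y * g (x, y)"] i2 by (simp add: case_prod_beta')
  also have "\<dots> = (\<integral>x. indicator S x * excess x \<partial>M)"
    by (simp add: excess_def g_sym[of _ x for x])
  finally have e2: "(\<integral>z. indicator S (snd z) * g z \<partial>(M \<Otimes>\<^sub>M M)) = (\<integral>x. indicator S x * excess x \<partial>M)" .
  have "(\<integral>x. excess x \<partial>M) = (\<integral>z. g z \<partial>(M \<Otimes>\<^sub>M M))"
    using MM.integral_fst'[of g] MM.P.integrable_bounded[OF g g_bound] by (simp add: excess_def)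
  also have "\<dots> = (\<integral>z. indicator S (fst z) * g z + indicator S (snd z) * g z \<partial>(M \<Otimes>\<^sub>M M))"
    by (intro Bochner_Integration.integral_cong) (auto simp: indicator_def g_zero)
  finally show ?thesis using i1 i2 e1 e2 by simp
qed

text \<open>\<open>base_degree\<close> is constant on \<open>S\<close> and on its complement, so the
  mixed term combines the integrals of \<open>excess\<close> over the whole space and over
  \<open>S\<close>; both vanish.\<close>

lemma integral_kernel_degree_square:
  assumes "(\<integral>x. excess x \<partial>M) = 0"
  shows "(\<integral>x. (\<integral>y. kernel (x, y) \<partial>M) ^ 2 \<partial>M) =
    prob S * (- p * prob S) ^ 2 + (1 - prob S) * ((1 - p) * (1 - prob S)) ^ 2 + (\<integral>x. excess x ^ 2 \<partial>M)"
proof -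
  let ?r = "- p * prob S" and ?s = "(1 - p) * (1 - prob S)"
  have i0: "integrable M excess" by (rule integrable_bounded[OF _ excess_bound]) measurable
  have i1: "integrable M (\<lambda>x. indicator S x * excess x)"
    by (rule integrable_bounded[where B = 1]) (auto intro!: abs_mult_le_1 excess_bound)
  have i2: "integrable M (\<lambda>x. base_degree x ^ 2)"
    by (rule integrable_bounded[where B = 1]) (simp_all add: abs_square_le_1 base_degree_bound)
  have i3: "integrable M (\<lambda>x. excess x ^ 2)"
    by (rule integrable_bounded[where B = 1]) (simp_all add: abs_square_le_1 excess_bound)
  have z: "(\<integral>x. indicator S x * excess x \<partial>M) = 0"
    using integral_indicator_excess assms by simp
  have "(\<integral>x. (\<integral>y. kernel (x, y) \<partial>M) ^ 2 \<partial>M) =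
      (\<integral>x. base_degree x ^ 2 + excess x ^ 2 + (2 * (?r - ?s) * (indicator S x * excess x) + 2 * ?s * excess x) \<partial>M)"
    by (intro Bochner_Integration.integral_cong)
       (auto simp: integral_kernel base_degree_def indicator_def power2_eq_square algebra_simps)
  also have "\<dots> = (\<integral>x. base_degree x ^ 2 \<partial>M) + (\<integral>x. excess x ^ 2 \<partial>M)"
    using i0 i1 i2 i3 z assms by simp
  finally show ?thesis using integral_base_degree_power[of 2] by simp
qed

text \<open>
  With \<open>h z\<close> the integral of \<open>g (x, z)\<close> over \<open>x \<in> A\<close>, the integral of \<open>h\<^sup>2\<close> is that of the codegree over
  \<open>A \<times> A\<close>, so \<open>g\<close> integrates to 0 over every rectangle.
\<close>

lemma AE_zero_if_codegree_zero:
  assumes "(\<integral>x. \<integral>y. codegree x y ^ 2 \<partial>M \<partial>M) = 0"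
  shows "AE z in M \<Otimes>\<^sub>M M. g z = 0"
proof -
  have cb: "\<bar>codegree x y\<bar> \<le> 1" for x y
  proof (cases "(\<lambda>z. g (x, z) * g (y, z)) \<in> borel_measurable M")
    case True
    then show ?thesis unfolding codegree_def by (rule abs_integral_le) (intro abs_mult_le_1 g_bound)
  next
    case False
    then have "\<not> integrable M (\<lambda>z. g (x, z) * g (y, z))" by auto
    then show ?thesis by (simp add: codegree_def not_integrable_integral_eq)
  qed
  have c2: "integrable (M \<Otimes>\<^sub>M M) (\<lambda>(x, y). codegree x y ^ 2)"
  proof (rule MM.P.integrable_bounded)
    show "(\<lambda>(x, y). codegree x y ^ 2) \<in> borel_measurable (M \<Otimes>\<^sub>M M)" by measurable
    show "\<bar>case z of (x, y) \<Rightarrow> codegree x y ^ 2\<bar> \<le> 1" for z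
      using cb by (auto simp: abs_square_le_1 split: prod.split)
  qed
  have "(\<integral>z. (case z of (x, y) \<Rightarrow> codegree x y ^ 2) \<partial>(M \<Otimes>\<^sub>M M)) = 0"
    using MM.integral_fst[OF c2] assms by simp
  then have "AE z in M \<Otimes>\<^sub>M M. (case z of (x, y) \<Rightarrow> codegree x y ^ 2) = 0"
    using integral_nonneg_eq_0_iff_AE[OF c2] by (auto simp: case_prod_beta')
  then have "AE z in M \<Otimes>\<^sub>M M. codegree (fst z) (snd z) = 0" by (auto simp: case_prod_beta')
  from MM.AE_pair[OF this] have c0: "AE x in M. AE y in M. codegree x y = 0" by simp
  have rect: "(\<integral>z. indicator (A \<times> B) z * g z \<partial>(M \<Otimes>\<^sub>M M)) = 0"
    if [measurable]: "A \<in> sets M" "B \<in> sets M" for A B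
  proof -
    define h where "h z = (\<integral>x. indicator A x * g (x, z) \<partial>M)" for z
    have h_m [measurable]: "h \<in> borel_measurable M" unfolding h_def by measurable
    have ind: "\<bar>indicator A x * c\<bar> \<le> 1" if "\<bar>c\<bar> \<le> 1" for x and c :: real and A :: "'b set"
      using that by (auto simp: indicator_def)
    have hb: "\<bar>h z\<bar> \<le> 1" if "z \<in> space M" for z
      unfolding h_def using that by (intro abs_integral_le ind g_bound) measurable
    have gh: "(\<integral>z. g (x, z) * h z \<partial>M) = (\<integral>y. indicator A y * codegree x y \<partial>M)" if x: "x \<in> space M" for x
    proof -
      have "integrable (M \<Otimes>\<^sub>M M) (\<lambda>(y, z). g (x, z) * (indicator A y * g (y, z)))"
        using x by (intro MM.P.integrable_bounded[where B = 1])
          (measurable, auto split: prod.split intro!: abs_mult_le_1 ind g_bound)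
      from MM.Fubini_integral[OF this]
      have "(\<integral>z. \<integral>y. g (x, z) * (indicator A y * g (y, z)) \<partial>M \<partial>M) =
          (\<integral>y. \<integral>z. indicator A y * (g (x, z) * g (y, z)) \<partial>M \<partial>M)"
        by (simp add: mult_ac)
      then show ?thesis by (simp add: h_def codegree_def)
    qed
    have hh: "integrable M (\<lambda>z. h z ^ 2)"
      by (rule integrable_const_bound[where B = 1])
         (auto intro!: AE_I2 hb simp: abs_square_le_1)
    have i: "integrable (M \<Otimes>\<^sub>M M) (\<lambda>(x, z). h z * (indicator A x * g (x, z)))"
      by (rule MM.P.integrable_const_bound[where B = 1])
         (auto intro!: AE_I2 abs_mult_le_1 ind hb g_bound simp: space_pair_measure)
    have "(\<integral>z. h z ^ 2 \<partial>M) = (\<integral>z. \<integral>x. h z * (indicator A x * g (x, z)) \<partial>M \<partial>M)"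
      by (simp add: h_def power2_eq_square)
    also have "\<dots> = (\<integral>x. \<integral>z. h z * (indicator A x * g (x, z)) \<partial>M \<partial>M)"
      by (rule MM.Fubini_integral[OF i])
    also have "\<dots> = (\<integral>x. \<integral>z. indicator A x * (g (x, z) * h z) \<partial>M \<partial>M)"
      by (simp add: mult_ac)
    also have "\<dots> = (\<integral>x. indicator A x * (\<integral>z. g (x, z) * h z \<partial>M) \<partial>M)"
      by simp
    also have "\<dots> = (\<integral>x. indicator A x * (\<integral>y. indicator A y * codegree x y \<partial>M) \<partial>M)"
      by (intro Bochner_Integration.integral_cong) (simp_all add: gh)
    also have "\<dots> = (\<integral>x. 0 \<partial>M)"
    proof (rule integral_cong_AE)
      show "AE x in M. indicator A x * (\<integral>y. indicator A y * codegree x y \<partial>M) = 0"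
        using c0
      proof eventually_elim
        case (elim x)
        then have "AE y in M. indicator A y * codegree x y = 0" by eventually_elim simp
        then show ?case by (simp add: integral_eq_zero_AE)
      qed
    qed measurable
    finally have "AE z in M. h z = 0"
      using integral_nonneg_eq_0_iff_AE[OF hh] by simp
    then have "(\<integral>z. indicator B z * h z \<partial>M) = 0"
      by (intro integral_eq_zero_AE) auto
    moreover have "integrable (M \<Otimes>\<^sub>M M) (\<lambda>(x, z). indicator B z * (indicator A x * g (x, z)))"
      by (rule MM.P.integrable_bounded[where B = 1])
         (measurable, auto split: prod.split intro!: ind g_bound)
    from MM.integral_snd[OF this]
    have "(\<integral>z. indicator B z * h z \<partial>M) = (\<integral>(x, z). indicator B z * (indicator A x * g (x, z)) \<partial>(M \<Otimes>\<^sub>M M))"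
      by (simp add: h_def)
    also have "\<dots> = (\<integral>z. indicator (A \<times> B) z * g z \<partial>(M \<Otimes>\<^sub>M M))"
      by (intro Bochner_Integration.integral_cong) (auto simp: indicator_def)
    ultimately show ?thesis by simp
  qed
  have gi: "integrable (M \<Otimes>\<^sub>M M) g" by (rule MM.P.integrable_bounded[OF g g_bound])
  have gi': "integrable (M \<Otimes>\<^sub>M M) (\<lambda>z. indicator C z * g z)" if "C \<in> sets (M \<Otimes>\<^sub>M M)" for C
    using integrable_mult_indicator[OF that gi] by simp
  \<comment> \<open>Supplies the complement case of the Dynkin-system induction that extends
    \<open>rect\<close> to all measurable sets.\<close>
  have full: "(\<integral>z. g z \<partial>(M \<Otimes>\<^sub>M M)) = 0"
  proof -
    have "(\<integral>z. indicator (space M \<times> space M) z * g z \<partial>(M \<Otimes>\<^sub>M M)) = 0" by (rule rect) auto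
    also have "(\<integral>z. indicator (space M \<times> space M) z * g z \<partial>(M \<Otimes>\<^sub>M M)) = (\<integral>z. g z \<partial>(M \<Otimes>\<^sub>M M))"
      by (intro Bochner_Integration.integral_cong) (auto simp: space_pair_measure)
    finally show ?thesis .
  qed
  have all: "(\<integral>z. indicator C z * g z \<partial>(M \<Otimes>\<^sub>M M)) = 0" if "C \<in> sets (M \<Otimes>\<^sub>M M)" for C
    using that unfolding sets_pair_measure
  proof (induct rule: sigma_sets_induct_disjoint[OF Int_stable_pair_measure_generator pair_measure_closed, consumes 1, case_names basic empty compl union])
    case (basic C)
    then show ?case using rect by auto
  next
    case empty
    show ?case by simp
  next
    case (compl C)
    then have C: "C \<in> sets (M \<Otimes>\<^sub>M M)" by (simp add: sets_pair_measure)
    have "(\<integral>z. indicator (space M \<times> space M - C) z * g z \<partial>(M \<Otimes>\<^sub>M M)) =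
        (\<integral>z. g z - indicator C z * g z \<partial>(M \<Otimes>\<^sub>M M))"
      by (intro Bochner_Integration.integral_cong) (auto simp: space_pair_measure indicator_def)
    also have "\<dots> = 0" using gi gi'[OF C] full compl by simp
    finally show ?case .
  next
    case (union F)
    then have F: "F i \<in> sets (M \<Otimes>\<^sub>M M)" for i by (auto simp: sets_pair_measure)
    have "(\<integral>z\<in>(\<Union>i. F i). g z \<partial>(M \<Otimes>\<^sub>M M)) = (\<Sum>i. (\<integral>z\<in>(F i). g z \<partial>(M \<Otimes>\<^sub>M M)))"
      using union(1) F gi'[of "\<Union>i. F i"]
      by (intro lebesgue_integral_countable_add) (auto simp: disjoint_family_on_def set_integrable_def)
    then show ?case using union(3) by (simp add: set_lebesgue_integral_def)
  qed
  have "AE z in M \<Otimes>\<^sub>M M. g z = (\<lambda>_. 0) z"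
    by (rule density_unique_real[OF gi]) (use all in \<open>auto simp: set_lebesgue_integral_def\<close>)
  then show ?thesis by simp
qed

end

section \<open>The product of all six kernel values on four points\<close>

context cross_kernel
begin

text \<open>The contribution of the triangle opposite a lone point \<open>x\<close>: if
  \<open>x\<close> is in \<open>S\<close>, the other three lie outside and give \<open>1 - p\<close>
  each, otherwise they give \<open>-p\<close> each.\<close>

definition star_weight :: "'a \<Rightarrow> real" where
  "star_weight x = (if x \<in> S then (1 - p) ^ 3 else (- p) ^ 3)"

text \<open>All four points in one part: six equal values of \<open>base\<close> are multiplied, and
  \<open>(-p)^6\<close> is \<open>p^6\<close>.\<close>

definition pure_part :: "'a \<Rightarrow> 'a \<Rightarrow> 'a \<Rightarrow> 'a \<Rightarrow> real" where
  "pure_part a b c d =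
     p ^ 6 * (indicator S a * (indicator S b * (indicator S c * indicator S d))) +
     (1 - p) ^ 6 * ((1 - indicator S a) * ((1 - indicator S b) * ((1 - indicator S c) * (1 - indicator S d))))"

definition star :: "'a \<Rightarrow> 'a \<Rightarrow> 'a \<Rightarrow> 'a \<Rightarrow> real" where
  "star a b c d = star_weight a * (g (a, b) * (g (a, c) * g (a, d)))"

text \<open>The 4-cycle with opposite pairs \<open>{a, b}\<close> and \<open>{c, d}\<close>, grouped
  so that integration over \<open>c\<close> and over \<open>d\<close> gives one factor
  \<open>codegree a b\<close> each.\<close>

definition cycle :: "'a \<Rightarrow> 'a \<Rightarrow> 'a \<Rightarrow> 'a \<Rightarrow> real" where
  "cycle a b c d = (g (a, c) * g (b, c)) * (g (a, d) * g (b, d))"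

text \<open>
  Since \<open>g\<close> only lives on pairs separated by \<open>S\<close>, exactly one type of term survives for each
  distribution of the four points over \<open>S\<close> and its complement: 4--0, 3--1, 2--2.
\<close>

lemma prod_kernel_expand:
  "kernel (a, b) * kernel (a, c) * kernel (a, d) * kernel (b, c) * kernel (b, d) * kernel (c, d) =
    pure_part a b c d + (star a b c d + star b a c d + star c a b d + star d a b c)
    - p * (1 - p) * (cycle a b c d + cycle a c b d + cycle a d b c)"
proof -
  have sym: "g (b, a) = g (a, b)" "g (c, a) = g (a, c)" "g (d, a) = g (a, d)"
    "g (c, b) = g (b, c)" "g (d, b) = g (b, d)" "g (d, c) = g (c, d)"
    by (rule g_sym)+
  show ?thesis
    unfolding pure_part_def star_def cycle_def kernel_def star_weight_def sym
    by (cases "a \<in> S"; cases "b \<in> S"; cases "c \<in> S"; cases "d \<in> S")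
       (simp_all add: base_def g_zero power_numeral_reduce algebra_simps)
qed

lemma star_weight_measurable [measurable]: "star_weight \<in> borel_measurable M"
  unfolding star_weight_def by measurable

lemma star_weight_bound: "\<bar>star_weight x\<bar> \<le> 1"
  using p by (auto simp: star_weight_def power_abs power_le_one)

lemma star_bound: "\<bar>star a b c d\<bar> \<le> 1"
  unfolding star_def by (intro abs_mult_le_1 star_weight_bound g_bound)

lemma cycle_bound: "\<bar>cycle a b c d\<bar> \<le> 1"
  unfolding cycle_def by (intro abs_mult_le_1 g_bound)

lemma pure_part_bound: "\<bar>pure_part a b c d\<bar> \<le> 1"
  using p by (auto simp: pure_part_def indicator_def power_le_one)

context
  fixes I :: "'i set" and i j k l :: 'i
  assumes I: "I = {i, j, k, l}" and dist: "distinct [i, j, k, l]"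
begin

lemma integral_star:
  assumes "AE x in M. excess x = 0"
  shows "(\<integral>x. star (x i) (x j) (x k) (x l) \<partial>PiM I (\<lambda>_. M)) = 0"
proof -
  have "(\<integral>x. star (x i) (x j) (x k) (x l) \<partial>PiM I (\<lambda>_. M)) =
      (\<integral>a. \<integral>b. \<integral>c. \<integral>d. star a b c d \<partial>M \<partial>M \<partial>M \<partial>M)"
    unfolding I using dist
    by (subst integral_PiM_four[OF dist _ star_bound], simp add: star_def, simp)
  also have "\<dots> = (\<integral>a. star_weight a * excess a ^ 3 \<partial>M)"
    by (simp add: star_def excess_def power3_eq_cube mult_ac)
  also have "\<dots> = 0"
    using assms by (intro integral_eq_zero_AE) auto
  finally show ?thesis .
qed

lemma integral_cycle:
  "(\<integral>x. cycle (x i) (x j) (x k) (x l) \<partial>PiM I (\<lambda>_. M)) = (\<integral>a. \<integral>b. codegree a b ^ 2 \<partial>M \<partial>M)"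
proof -
  have "(\<integral>x. cycle (x i) (x j) (x k) (x l) \<partial>PiM I (\<lambda>_. M)) =
      (\<integral>a. \<integral>b. \<integral>c. \<integral>d. cycle a b c d \<partial>M \<partial>M \<partial>M \<partial>M)"
    unfolding I using dist
    by (subst integral_PiM_four[OF dist _ cycle_bound], simp add: cycle_def, simp)
  then show ?thesis by (simp add: cycle_def codegree_def power2_eq_square)
qed

lemma integral_pure_part:
  "(\<integral>x. pure_part (x i) (x j) (x k) (x l) \<partial>PiM I (\<lambda>_. M)) =
    p ^ 6 * prob S ^ 4 + (1 - p) ^ 6 * (1 - prob S) ^ 4"
proof -
  interpret P: prob_space "PiM I (\<lambda>_. M)"
    by (intro prob_space_PiM prob_space_axioms)
  define q where "q u x = (u (x i) * (u (x j) * (u (x k) * u (x l))) :: real)" for u and x :: "'i \<Rightarrow> 'a"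
  have q_m: "q u \<in> borel_measurable (PiM I (\<lambda>_. M))" if [measurable]: "u \<in> borel_measurable M" for u
    unfolding q_def I by measurable
  have q_bound: "\<bar>q u x\<bar> \<le> 1" if "\<And>x. \<bar>u x\<bar> \<le> 1" for u x
    unfolding q_def by (intro abs_mult_le_1 that)
  have q_int: "(\<integral>x. q u x \<partial>PiM I (\<lambda>_. M)) = (\<integral>x. u x \<partial>M) ^ 4"
    if u: "u \<in> borel_measurable M" and ub: "\<And>x. \<bar>u x\<bar> \<le> 1" for u
  proof -
    have "(\<integral>x. q u x \<partial>PiM I (\<lambda>_. M)) =
        (\<integral>a. \<integral>b. \<integral>c. \<integral>d. u a * (u b * (u c * u d)) \<partial>M \<partial>M \<partial>M \<partial>M)"
      unfolding I using dist
      by (subst integral_PiM_four[OF dist q_m[OF u, unfolded I] q_bound[OF ub]]) (simp add: q_def)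
    then show ?thesis by (simp add: power_numeral_reduce)
  qed
  let ?u = "indicator S :: 'a \<Rightarrow> real" and ?w = "\<lambda>x. 1 - indicator S x :: real"
  have u: "?u \<in> borel_measurable M" "\<bar>?u x\<bar> \<le> 1" and w: "?w \<in> borel_measurable M" "\<bar>?w x\<bar> \<le> 1" for x
    by (auto simp: indicator_def)
  have int_w: "(\<integral>x. 1 - indicator S x \<partial>M) = 1 - prob S"
    using integral_indicator_S[of 0 1] by simp
  have "(\<integral>x. pure_part (x i) (x j) (x k) (x l) \<partial>PiM I (\<lambda>_. M)) =
      (\<integral>x. p ^ 6 * q ?u x + (1 - p) ^ 6 * q ?w x \<partial>PiM I (\<lambda>_. M))"
    by (simp add: pure_part_def q_def)
  also have "\<dots> = p ^ 6 * (\<integral>x. q ?u x \<partial>PiM I (\<lambda>_. M)) + (1 - p) ^ 6 * (\<integral>x. q ?w x \<partial>PiM I (\<lambda>_. M))"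
    using P.integrable_bounded[OF q_m[OF u(1)] q_bound[OF u(2)]]
      P.integrable_bounded[OF q_m[OF w(1)] q_bound[OF w(2)]] by simp
  finally show ?thesis unfolding q_int[OF u] q_int[OF w] int_w by simp
qed

end

lemma integral_prod_kernel:
  assumes I: "I = {i, j, k, l}" and dist: "distinct [i, j, k, l]" and "AE x in M. excess x = 0"
  shows "(\<integral>x. kernel (x i, x j) * kernel (x i, x k) * kernel (x i, x l) * kernel (x j, x k) * kernel (x j, x l)
      * kernel (x k, x l) \<partial>PiM I (\<lambda>_. M)) =
    p ^ 6 * prob S ^ 4 + (1 - p) ^ 6 * (1 - prob S) ^ 4
    - 3 * p * (1 - p) * (\<integral>a. \<integral>b. codegree a b ^ 2 \<partial>M \<partial>M)"
proof -
  interpret P: prob_space "PiM I (\<lambda>_. M)"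
    by (intro prob_space_PiM prob_space_axioms)
  have star_i: "integrable (PiM I (\<lambda>_. M)) (\<lambda>x. star (x a) (x b) (x c) (x d))"
    if "{a, b, c, d} \<subseteq> I" for a b c d
    using that by (intro P.integrable_bounded[OF _ star_bound]) (simp add: star_def)
  have cycle_i: "integrable (PiM I (\<lambda>_. M)) (\<lambda>x. cycle (x a) (x b) (x c) (x d))"
    if "{a, b, c, d} \<subseteq> I" for a b c d
    using that by (intro P.integrable_bounded[OF _ cycle_bound]) (simp add: cycle_def)
  have pure_i: "integrable (PiM I (\<lambda>_. M)) (\<lambda>x. pure_part (x i) (x j) (x k) (x l))"
    unfolding I by (intro P.integrable_bounded[unfolded I, OF _ pure_part_bound]) (simp add: pure_part_def)
  have "(\<integral>x. star (x i) (x j) (x k) (x l) \<partial>PiM I (\<lambda>_. M)) = 0"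
    "(\<integral>x. star (x j) (x i) (x k) (x l) \<partial>PiM I (\<lambda>_. M)) = 0"
    "(\<integral>x. star (x k) (x i) (x j) (x l) \<partial>PiM I (\<lambda>_. M)) = 0"
    "(\<integral>x. star (x l) (x i) (x j) (x k) \<partial>PiM I (\<lambda>_. M)) = 0"
    "(\<integral>x. cycle (x i) (x j) (x k) (x l) \<partial>PiM I (\<lambda>_. M)) = (\<integral>a. \<integral>b. codegree a b ^ 2 \<partial>M \<partial>M)"
    "(\<integral>x. cycle (x i) (x k) (x j) (x l) \<partial>PiM I (\<lambda>_. M)) = (\<integral>a. \<integral>b. codegree a b ^ 2 \<partial>M \<partial>M)"
    "(\<integral>x. cycle (x i) (x l) (x j) (x k) \<partial>PiM I (\<lambda>_. M)) = (\<integral>a. \<integral>b. codegree a b ^ 2 \<partial>M \<partial>M)"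
    "(\<integral>x. pure_part (x i) (x j) (x k) (x l) \<partial>PiM I (\<lambda>_. M)) = p ^ 6 * prob S ^ 4 + (1 - p) ^ 6 * (1 - prob S) ^ 4"
    \<comment> \<open>As \<open>I\<close> is only required to equal the set of the four indices, the
      same lemmas apply to every permutation of them over one fixed measure.\<close>
    using dist assms(3) by (intro integral_star integral_cycle integral_pure_part; auto simp: I)+
  moreover have "i \<in> I" "j \<in> I" "k \<in> I" "l \<in> I" by (simp_all add: I)
  ultimately show ?thesis
    unfolding prod_kernel_expand by (simp add: star_i cycle_i pure_i)
qed

end

section \<open>The 4-sample\<close>

lemma measure_unit_lborel_unit: "measure unit_lborel {0..1} = 1"
  by (simp add: measure_unit_lborel)

section \<open>Integrals over one edge and over two edges of the sample\<close>

context
  fixes K :: "real \<times> real \<Rightarrow> real"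
  assumes K: "K \<in> borel_measurable (unit_lborel \<Otimes>\<^sub>M unit_lborel)"
    and K_bound: "\<And>z. \<bar>K z\<bar> \<le> 1"
    and K_sym: "\<And>x y. K (x, y) = K (y, x)"
begin

lemma edge_kernel_eq:
  assumes "e = {i, j}" "i \<noteq> (j :: nat)"
  shows "K (x (Min e), x (Max e)) = K (x i, x j)"
  using assms K_sym by (cases "i < j") (auto simp: min_def max_def)

lemma edge_kernel_measurable:
  assumes "e \<in> vertex_pairs k"
  shows "(\<lambda>x. K (x (Min e), x (Max e))) \<in> borel_measurable (PiM {1..k} (\<lambda>_. unit_lborel))"
  using assms K by (elim vertex_pairE) (simp, measurable)

lemma integral_sum_edges:
  "(\<integral>x. (\<Sum>e\<in>vertex_pairs k. K (x (Min e), x (Max e))) \<partial>PiM {1..k} (\<lambda>_. unit_lborel)) =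
    card (vertex_pairs k) * (\<integral>x. \<integral>y. K (x, y) \<partial>unit_lborel \<partial>unit_lborel)"
proof -
  interpret P: prob_space "PiM {1..k} (\<lambda>_. unit_lborel)"
    by (intro prob_space_PiM unit_lborel.prob_space_axioms)
  have "(\<integral>x. K (x (Min e), x (Max e)) \<partial>PiM {1..k} (\<lambda>_. unit_lborel)) =
      (\<integral>x. \<integral>y. K (x, y) \<partial>unit_lborel \<partial>unit_lborel)" if "e \<in> vertex_pairs k" for e
    using that
  proof (rule vertex_pairE)
    fix i j assume e: "Min e = i" "Max e = j" "i < j" "i \<in> {1..k}" "j \<in> {1..k}"
    have "(\<integral>x. K (x i, x j) \<partial>PiM {1..k} (\<lambda>_. unit_lborel)) =
        (\<integral>z. K z \<partial>distr (PiM {1..k} (\<lambda>_. unit_lborel)) (unit_lborel \<Otimes>\<^sub>M unit_lborel) (\<lambda>x. (x i, x j)))"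
      by (rule integral_distr[symmetric, OF _ K]) (use e in measurable)
    also have "\<dots> = (\<integral>z. K z \<partial>(unit_lborel \<Otimes>\<^sub>M unit_lborel))"
      by (subst unit_lborel.distr_PiM_pair) (use e in auto)
    also have "\<dots> = (\<integral>x. \<integral>y. K (x, y) \<partial>unit_lborel \<partial>unit_lborel)"
      by (rule unit_lborel2.integral_fst'[symmetric] unit_lborel2.P.integrable_bounded[OF K K_bound])+
    finally show ?thesis using e by simp
  qed
  moreover have "integrable (PiM {1..k} (\<lambda>_. unit_lborel)) (\<lambda>x. K (x (Min e), x (Max e)))"
    if "e \<in> vertex_pairs k" for e
    by (rule P.integrable_bounded[OF edge_kernel_measurable[OF that] K_bound])
  ultimately show ?thesis
    by (subst Bochner_Integration.integral_sum) (auto simp del: One_nat_def)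
qed

text \<open>Disjoint edges involve independent points, whence a squared mean. Otherwise there is
  exactly one common vertex; once its point is fixed, the two remaining integrals are independent
  and equal to the same degree.\<close>

lemma integral_edge_pair:
  assumes e: "e \<in> vertex_pairs 4" and f: "f \<in> vertex_pairs 4" and "e \<noteq> f"
  shows "(\<integral>x. K (x (Min e), x (Max e)) * K (x (Min f), x (Max f)) \<partial>PiM {1..4} (\<lambda>_. unit_lborel)) =
    (if e \<inter> f = {} then (\<integral>x. \<integral>y. K (x, y) \<partial>unit_lborel \<partial>unit_lborel) ^ 2
     else (\<integral>x. (\<integral>y. K (x, y) \<partial>unit_lborel) ^ 2 \<partial>unit_lborel))"
proof -
  have four: "(\<integral>x. K (x i1, x i2) * K (x i3, x i4) \<partial>PiM {1..4} (\<lambda>_. unit_lborel)) =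
      (\<integral>a. \<integral>b. \<integral>c. \<integral>d. K (z a b c d i1, z a b c d i2) * K (z a b c d i3, z a b c d i4)
        \<partial>unit_lborel \<partial>unit_lborel \<partial>unit_lborel \<partial>unit_lborel)"
    if z: "z = (\<lambda>a b c d. (\<lambda>_. undefined)(i := a, j := b, k := c, l := d))"
      and dist: "distinct [i, j, k, l]" and I: "{1..4} = {i, j, k, l}" "{i1, i2, i3, i4} \<subseteq> {1..4}"
    for z and i j k l i1 i2 i3 i4 :: nat
    unfolding I(1) z
  proof (rule unit_lborel.integral_PiM_four[OF dist, where B = 1])
    show "(\<lambda>x. K (x i1, x i2) * K (x i3, x i4)) \<in> borel_measurable (PiM {i, j, k, l} (\<lambda>_. unit_lborel))"
      using I K unfolding I(1) by (simp, measurable)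
  qed (intro abs_mult_le_1 K_bound)
  from e obtain i' j' where ij': "e = {i', j'}" "i' < j'" "{i', j'} \<subseteq> {1..4}" by (auto elim!: vertex_pairE)
  from f obtain k' l' where kl': "f = {k', l'}" "k' < l'" "{k', l'} \<subseteq> {1..4}" by (auto elim!: vertex_pairE)
  show ?thesis
  proof (cases "e \<inter> f = {}")
    case True
    then have dist: "distinct [i', j', k', l']" using ij' kl' by auto
    have "{i', j', k', l'} \<subseteq> {1..4}" using ij'(3) kl'(3) by simp
    then have I: "{1..4} = {i', j', k', l'}"
      using dist by (intro card_subset_eq[symmetric]) simp_all
    show ?thesis
      using True ij'(2) kl'(2) dist I
      by (subst edge_kernel_eq[OF ij'(1)], simp, subst edge_kernel_eq[OF kl'(1)], simp,
          subst four[OF refl dist I]) (simp_all add: power2_eq_square measure_unit_lborel_unit)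
  next
    case False
    then obtain i j k where ijk: "e = {i, j}" "f = {i, k}" "i \<noteq> j" "i \<noteq> k" "j \<noteq> k"
    proof -
      from False obtain i where i: "i \<in> e" "i \<in> f" by auto
      have "\<exists>j. e = {i, j} \<and> i \<noteq> j" using i(1) ij'(1,2) by auto
      moreover have "\<exists>k. f = {i, k} \<and> i \<noteq> k" using i(2) kl'(1,2) by auto
      ultimately show ?thesis using that \<open>e \<noteq> f\<close> by metis
    qed
    \<comment> \<open>The fourth vertex lies on neither edge and is integrated out.\<close>
    have "card {i, j, k} < card {1..4::nat}" using ijk by simp
    then obtain l where l: "l \<in> {1..4}" "l \<notin> {i, j, k}"
      by (metis card_mono finite.emptyI finite.insertI linorder_not_le subsetI)
    have dist: "distinct [i, j, k, l]" using ijk l by auto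
    have "{i, j, k} \<subseteq> e \<union> f" unfolding ijk(1,2) by simp
    moreover have "e \<union> f \<subseteq> {1..4}" using ij'(1,3) kl'(1,3) by simp
    ultimately have "{i, j, k} \<subseteq> {1..4}" by (rule subset_trans)
    with l have "{i, j, k, l} \<subseteq> {1..4}" by simp
    then have I: "{1..4} = {i, j, k, l}"
      using dist by (intro card_subset_eq[symmetric]) simp_all
    show ?thesis
      using False dist I
      by (subst edge_kernel_eq[OF ijk(1,3)], subst edge_kernel_eq[OF ijk(2,4)],
          subst four[OF refl dist I]) (simp_all add: power2_eq_square measure_unit_lborel_unit)
  qed
qed

lemma integral_sum_edge_pairs:
  defines "m \<equiv> \<integral>x. \<integral>y. K (x, y) \<partial>unit_lborel \<partial>unit_lborel"
    and "q \<equiv> \<integral>x. (\<integral>y. K (x, y) \<partial>unit_lborel) ^ 2 \<partial>unit_lborel"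
  shows "(\<integral>x. (\<Sum>e\<in>vertex_pairs 4. \<Sum>f\<in>vertex_pairs 4 - {e}.
      K (x (Min e), x (Max e)) * K (x (Min f), x (Max f))) \<partial>PiM {1..4} (\<lambda>_. unit_lborel)) =
    (\<Sum>e\<in>vertex_pairs 4. \<Sum>f\<in>vertex_pairs 4 - {e}. if e \<inter> f = {} then m ^ 2 else q)"
proof -
  interpret P: prob_space "PiM {1..4} (\<lambda>_. unit_lborel)"
    by (intro prob_space_PiM unit_lborel.prob_space_axioms)
  have int: "integrable (PiM {1..4} (\<lambda>_. unit_lborel)) (\<lambda>x. K (x (Min e), x (Max e)) * K (x (Min f), x (Max f)))"
    if "e \<in> vertex_pairs 4" "f \<in> vertex_pairs 4" for e f
    by (rule P.integrable_bounded[where B = 1])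
       (intro borel_measurable_times edge_kernel_measurable that abs_mult_le_1 K_bound)+
  have "(\<integral>x. (\<Sum>e\<in>vertex_pairs 4. \<Sum>f\<in>vertex_pairs 4 - {e}.
      K (x (Min e), x (Max e)) * K (x (Min f), x (Max f))) \<partial>PiM {1..4} (\<lambda>_. unit_lborel)) =
    (\<Sum>e\<in>vertex_pairs 4. \<Sum>f\<in>vertex_pairs 4 - {e}.
      (\<integral>x. K (x (Min e), x (Max e)) * K (x (Min f), x (Max f)) \<partial>PiM {1..4} (\<lambda>_. unit_lborel)))"
  proof (subst Bochner_Integration.integral_sum)
    show "integrable (PiM {1..4} (\<lambda>_. unit_lborel))
        (\<lambda>x. \<Sum>f\<in>vertex_pairs 4 - {e}. K (x (Min e), x (Max e)) * K (x (Min f), x (Max f)))"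
      if "e \<in> vertex_pairs 4" for e
      by (intro Bochner_Integration.integrable_sum int that) auto
  qed (intro sum.cong refl Bochner_Integration.integral_sum int, auto)
  also have "\<dots> = (\<Sum>e\<in>vertex_pairs 4. \<Sum>f\<in>vertex_pairs 4 - {e}. if e \<inter> f = {} then m ^ 2 else q)"
    unfolding m_def q_def by (intro sum.cong refl integral_edge_pair) auto
  finally show ?thesis .
qed

end

lemma vertex_pairs_4: "vertex_pairs 4 = {{1, 2}, {1, 3}, {1, 4}, {2, 3}, {2, 4}, {3, 4}}"
proof
  show "vertex_pairs 4 \<subseteq> {{1, 2}, {1, 3}, {1, 4}, {2, 3}, {2, 4}, {3, 4}}"
  proof
    fix e assume "e \<in> vertex_pairs 4"
    then obtain i j where e: "e = {i, j}" "i < j" "i \<in> {1..4}" "j \<in> {1..4}" by (rule vertex_pairE)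
    have eq: "{1..4} = {1, 2, 3, 4 :: nat}" by auto
    from e(2-4) show "e \<in> {{1, 2}, {1, 3}, {1, 4}, {2, 3}, {2, 4}, {3, 4}}"
      unfolding e(1) eq by (elim insertE emptyE) simp_all
  qed
qed (simp add: vertex_pairs_def)

lemma prod_vertex_pairs_4:
  "(\<Prod>e\<in>vertex_pairs 4. K (x (Min e), x (Max e))) =
    K (x 1, x 2) * K (x 1, x 3) * K (x 1, x 4) * K (x 2, x 3) * K (x 2, x 4) * (K (x 3, x 4) :: real)"
  unfolding vertex_pairs_4 by (simp add: doubleton_eq_iff mult_ac del: One_nat_def)

section \<open>Split graphons as perturbed step kernels\<close>

lemma split_graphon_measurable:
  assumes [measurable]: "S \<in> sets unit_lborel" and v [measurable]: "v \<in> borel_measurable borel"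
  shows "split_graphon S v \<in> borel_measurable (unit_lborel \<Otimes>\<^sub>M unit_lborel)"
proof -
  have [measurable]: "v \<in> borel_measurable (unit_lborel \<Otimes>\<^sub>M unit_lborel)"
    by (rule borel_measurable_unit_square[OF v])
  show ?thesis unfolding split_graphon_def by measurable
qed

lemma split_graphon_range: "(\<And>z. v z \<in> {0..1}) \<Longrightarrow> split_graphon S v z \<in> {0..1}"
  by (cases z) (simp add: split_graphon_def)

lemma cross_kernel_split_graphon:
  assumes S: "S \<in> sets unit_lborel" and v: "v \<in> borel_measurable borel" "\<And>z. v z \<in> {0..1}" and p: "p \<in> {0..1}"
  shows "cross_kernel unit_lborel S (\<lambda>z. split_graphon S v z - split_graphon S (\<lambda>_. p) z) p"
proof
  show "(\<lambda>z. split_graphon S v z - split_graphon S (\<lambda>_. p) z) \<in> borel_measurable (unit_lborel \<Otimes>\<^sub>M unit_lborel)"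
    by (intro borel_measurable_diff split_graphon_measurable S v) simp
  show "\<bar>split_graphon S v z - split_graphon S (\<lambda>_. p) z\<bar> \<le> 1" for z
    using split_graphon_range[of v S z, OF v(2)] split_graphon_range[of "\<lambda>_. p" S z] p by auto
qed (use S p in \<open>auto simp: split_graphon_def\<close>)

lemma kernel_split_graphon:
  assumes "cross_kernel unit_lborel S (\<lambda>z. split_graphon S v z - split_graphon S (\<lambda>_. p) z) p"
  shows "cross_kernel.kernel S (\<lambda>z. split_graphon S v z - split_graphon S (\<lambda>_. p) z) p = (\<lambda>z. split_graphon S v z - p)"
  using assms
  by (auto simp: fun_eq_iff cross_kernel.kernel_def cross_kernel.base_def split_graphon_def)

text \<open>The random graph depends on the points only through the parts containing them, and these
  labels are independent with a law determined by the measure of the part. This matters because the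
  set found for \<open>U\<close> need not be an interval.\<close>

lemma sample_split_graphon_cong:
  assumes S: "S \<in> sets unit_lborel" and T: "T \<in> sets unit_lborel"
    and eq: "measure unit_lborel S = measure unit_lborel T"
  shows "sample k (split_graphon S (\<lambda>_. p)) = sample k (split_graphon T (\<lambda>_. p))"
proof -
  \<comment> \<open>Label 0 marks \<open>R\<close> and label 1 the rest, so that on labels
    \<open>{0}\<close> plays the role of \<open>R\<close>.\<close>
  define t where "t R x = (if x \<in> R then 0 else 1 :: real)" for R :: "real set" and x
  define D where "D R = distr unit_lborel borel (t R)" for R
  let ?H = "split_graphon {0} (\<lambda>_. p)"
  have t_m [measurable]: "t R \<in> measurable unit_lborel borel" if [measurable]: "R \<in> sets unit_lborel" for R
    unfolding t_def by measurable
  have D_ps: "prob_space (D R)" if "R \<in> sets unit_lborel" for R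
    unfolding D_def using t_m[OF that] by (rule unit_lborel.prob_space_distr)
  have "D S = D T"
  proof (rule measure_eqI)
    fix A assume "A \<in> sets (D S)"
    then have A: "A \<in> sets borel" by (simp add: D_def)
    have *: "emeasure (D R) A = ennreal ((if 0 \<in> A then measure unit_lborel R else 0) +
        (if 1 \<in> A then 1 - measure unit_lborel R else 0))" if R: "R \<in> sets unit_lborel" for R
    proof -
      have "t R -` A \<inter> space unit_lborel =
        (if 0 \<in> A then if 1 \<in> A then space unit_lborel else R else if 1 \<in> A then space unit_lborel - R else {})"
        using sets.sets_into_space[OF R] by (auto simp: t_def split: if_splits)
      then have "measure unit_lborel (t R -` A \<inter> space unit_lborel) =
        (if 0 \<in> A then measure unit_lborel R else 0) + (if 1 \<in> A then 1 - measure unit_lborel R else 0)"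
        using unit_lborel.prob_compl[OF R] unit_lborel.prob_space by (simp del: space_restrict_space2)
      then show ?thesis
        unfolding D_def using R A
        by (subst emeasure_distr) (simp_all only: t_m unit_lborel.emeasure_eq_measure)
    qed
    show "emeasure (D S) A = emeasure (D T) A"
      unfolding *[OF S] *[OF T] eq ..
  qed (simp add: D_def)
  moreover have "emeasure (sample k (split_graphon R (\<lambda>_. p))) A =
      (\<integral>\<^sup>+y. emeasure (measure_pmf (random_graph k ?H y)) A \<partial>PiM {1..k} (\<lambda>_. D R))"
    if R: "R \<in> sets unit_lborel" for R A
  proof -
    note [measurable] = t_m[OF R]
    have H: "?H \<in> borel_measurable (D R \<Otimes>\<^sub>M D R)"
      unfolding split_graphon_def D_def by measurable
    have t_m': "t R \<in> measurable unit_lborel (D R)" by (simp add: D_def)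
    have "random_graph k (split_graphon R (\<lambda>_. p)) x = random_graph k ?H (compose {1..k} (t R) x)" for x
      by (rule random_graph_cong, erule vertex_pairE) (auto simp: split_graphon_def compose_def t_def)
    then have "emeasure (sample k (split_graphon R (\<lambda>_. p))) A =
        (\<integral>\<^sup>+x. emeasure (measure_pmf (random_graph k ?H (compose {1..k} (t R) x))) A \<partial>PiM {1..k} (\<lambda>_. unit_lborel))"
      by (subst emeasure_sample) (auto intro!: split_graphon_measurable R)
    also have "\<dots> = (\<integral>\<^sup>+y. emeasure (measure_pmf (random_graph k ?H y)) A
        \<partial>distr (PiM {1..k} (\<lambda>_. unit_lborel)) (PiM {1..k} (\<lambda>_. D R)) (compose {1..k} (t R)))"
    proof (subst nn_integral_distr)
      show "compose {1..k} (t R) \<in> measurable (PiM {1..k} (\<lambda>_. unit_lborel)) (PiM {1..k} (\<lambda>_. D R))"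
        unfolding compose_def
        by (intro measurable_restrict measurable_compose[OF _ t_m'] measurable_component_singleton)
    qed (use measurable_emeasure_kernel[OF measurable_random_graph[OF H]] in simp_all)
    also have "distr (PiM {1..k} (\<lambda>_. unit_lborel)) (PiM {1..k} (\<lambda>_. D R)) (compose {1..k} (t R)) =
        PiM {1..k} (\<lambda>_. distr unit_lborel (D R) (t R))"
      using t_m' D_ps[OF R] by (intro distr_PiM_finite_prob_space') (auto intro: unit_lborel.prob_space_axioms)
    also have "distr unit_lborel (D R) (t R) = D R"
      unfolding D_def by (rule distr_cong) simp_all
    finally show ?thesis .
  qed
  ultimately show ?thesis
    using S T by (intro measure_eqI) (simp_all add: sets_sample split_graphon_measurable)
qed

theorem theorem5:
  fixes a p :: real and W U :: "real \<times> real \<Rightarrow> real"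
  assumes "a \<in> {0..1}" and "p \<in> {0..1}"
    and "W = step_graphon a p"
    and "graphon U"
    and "independence_ratio U = independence_ratio W"
    and "clique_ratio U = clique_ratio W"
    and "edge_count_distr 4 U = edge_count_distr 4 W"
  shows "weakly_isomorphic U W"
proof -
  have "independence_ratio U = a" "clique_ratio U = 1 - a"
    using assms ratios_step_graphon by auto
  then obtain S where S: "measure unit_lborel S = a" "independent_set U S"
      "independent_set (\<lambda>z. 1 - U z) ({0..1} - S)"
    by (rule ex_independent_clique_partition)
  then have Sm: "S \<in> sets unit_lborel" by (simp add: independent_set_def)
  obtain v where v: "v \<in> borel_measurable borel" "\<And>z. v z \<in> {0..1}"
      and U: "AE z in unit_lborel \<Otimes>\<^sub>M unit_lborel. U z = split_graphon S v z"
    using ex_split_graphon[OF \<open>graphon U\<close> S(2,3)] by blast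
  define T where "T = {0..<a}"
  have "T \<subseteq> {0..1}" using \<open>a \<in> {0..1}\<close> by (auto simp: T_def)
  then have Tm: "T \<in> sets unit_lborel" and T: "measure unit_lborel T = a"
    using \<open>a \<in> {0..1}\<close> by (simp_all add: sets_unit_lborel measure_unit_lborel) (simp_all add: T_def)
  have W: "AE z in unit_lborel \<Otimes>\<^sub>M unit_lborel. W z = split_graphon T (\<lambda>_. p) z"
    using step_graphon_eq_split_graphon assms(3) by (simp add: T_def)
  have sU: "sample k U = sample k (split_graphon S v)" for k
    by (rule sample_cong_AE[OF split_graphon_measurable[OF Sm v(1)] U])
  have sW: "sample k W = sample k (split_graphon T (\<lambda>_. p))" for k
    by (rule sample_cong_AE[OF split_graphon_measurable[OF Tm] W]) simp
  let ?g = "\<lambda>z. split_graphon S v z - split_graphon S (\<lambda>_. p) z"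
  interpret X: cross_kernel unit_lborel S ?g p
    by (rule cross_kernel_split_graphon[OF Sm v \<open>p \<in> {0..1}\<close>])
  \<comment> \<open>The target is the unperturbed case \<open>g = 0\<close>, so each formula for it
    is an instance of the one used for \<open>U\<close>.\<close>
  interpret Y: cross_kernel unit_lborel T "\<lambda>_. 0" p
    using cross_kernel_split_graphon[OF Tm, of "\<lambda>_. p" p] \<open>p \<in> {0..1}\<close> by simp
  have XK: "split_graphon S v z - p = X.kernel z" for z
    by (rule kernel_split_graphon[OF X.cross_kernel_axioms, THEN fun_cong, symmetric])
  have YK: "split_graphon T (\<lambda>_. p) z - p = Y.kernel z" for z
    using kernel_split_graphon[of T "\<lambda>_. p" p] Y.cross_kernel_axioms by simp
  have Y0: "Y.excess = (\<lambda>_. 0)" "Y.codegree = (\<lambda>_ _. 0)"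
    by (simp_all add: fun_eq_iff Y.excess_def Y.codegree_def)
  have X_sym: "X.kernel (x, y) = X.kernel (y, x)" and Y_sym: "Y.kernel (x, y) = Y.kernel (y, x)" for x y
    by (rule X.kernel_sym, rule Y.kernel_sym)
  have pT: "(\<lambda>_. p) \<in> borel_measurable (borel :: (real \<times> real) measure)" "p \<in> {0..1}"
    using assms(2) by simp_all
  have "edge_count_distr 4 (split_graphon S v) = edge_count_distr 4 (split_graphon T (\<lambda>_. p))"
    using assms(7) unfolding edge_count_distr_def sU sW .
  note E = split_graphon_measurable[OF Sm v(1)] split_graphon_range[OF v(2)]
    split_graphon_measurable[OF Tm pT(1)] split_graphon_range[OF pT(2)] this
  note sum_eq = edge_count_distr_eq_sum[OF E, of p]
    and pair_eq = edge_count_distr_eq_sum_pairs[OF E, of p]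
    and prod_eq = edge_count_distr_eq_prod[OF E, of p]

  have mean: "(\<integral>x. \<integral>y. X.kernel (x, y) \<partial>unit_lborel \<partial>unit_lborel) =
      (\<integral>x. \<integral>y. Y.kernel (x, y) \<partial>unit_lborel \<partial>unit_lborel)"
    using sum_eq unfolding XK YK
      integral_sum_edges[OF X.kernel_measurable X.kernel_bound X_sym]
      integral_sum_edges[OF Y.kernel_measurable Y.kernel_bound Y_sym]
    by (simp add: vertex_pairs_4)
  \<comment> \<open>The unperturbed terms cancel: they depend only on \<open>p\<close> and on the
    measure of the part, which is \<open>a\<close> for both \<open>S\<close> and
    \<open>T\<close>.\<close>
  then have excess0: "(\<integral>x. X.excess x \<partial>unit_lborel) = 0"
    unfolding X.integral_kernel_mean Y.integral_kernel_mean by (simp add: S T Y0)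

  let ?qX = "\<integral>x. (\<integral>y. X.kernel (x, y) \<partial>unit_lborel) ^ 2 \<partial>unit_lborel"
  let ?qY = "\<integral>x. (\<integral>y. Y.kernel (x, y) \<partial>unit_lborel) ^ 2 \<partial>unit_lborel"
  have "?qX = ?qY"
  proof -
    \<comment> \<open>The number of ordered pairs of distinct intersecting edges, namely 24. It is
      the coefficient of the degree moment, and its positivity suffices for cancelling it.\<close>
    let ?N = "\<Sum>e\<in>vertex_pairs 4. \<Sum>f\<in>vertex_pairs 4 - {e}. if e \<inter> f = {} then 0 else 1 :: real"
    let ?m = "\<integral>x. \<integral>y. Y.kernel (x, y) \<partial>unit_lborel \<partial>unit_lborel"
    have split: "(\<Sum>e\<in>vertex_pairs 4. \<Sum>f\<in>vertex_pairs 4 - {e}. if e \<inter> f = {} then c else d) =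
        (\<Sum>e\<in>vertex_pairs 4. \<Sum>f\<in>vertex_pairs 4 - {e}. if e \<inter> f = {} then c else 0) + d * ?N" for c d :: real
      by (simp add: sum_distrib_left sum.distrib[symmetric] if_distrib cong: if_cong)
    have "(\<Sum>e\<in>vertex_pairs 4. \<Sum>f\<in>vertex_pairs 4 - {e}. if e \<inter> f = {} then ?m ^ 2 else ?qX) =
        (\<Sum>e\<in>vertex_pairs 4. \<Sum>f\<in>vertex_pairs 4 - {e}. if e \<inter> f = {} then ?m ^ 2 else ?qY)"
      using pair_eq unfolding XK YK
        integral_sum_edge_pairs[OF X.kernel_measurable X.kernel_bound X_sym]
        integral_sum_edge_pairs[OF Y.kernel_measurable Y.kernel_bound Y_sym] mean .
    then have "?qX * ?N = ?qY * ?N"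
      unfolding split[of "?m ^ 2" ?qX] split[of "?m ^ 2" ?qY] by (rule add_left_imp_eq)
    moreover have "?N > 0"
    proof (rule sum_pos2[of _ "{1, 2}"])
      show "0 < (\<Sum>f\<in>vertex_pairs 4 - {{1, 2}}. if {1, 2} \<inter> f = {} then 0 else 1 :: real)"
        by (rule sum_pos2[of _ "{1, 3}"]) (auto simp: vertex_pairs_4 doubleton_eq_iff)
    qed (auto simp: vertex_pairs_4 intro!: sum_nonneg)
    ultimately show ?thesis by simp
  qed
  then have "(\<integral>x. X.excess x ^ 2 \<partial>unit_lborel) = 0"
    using X.integral_kernel_degree_square[OF excess0] Y.integral_kernel_degree_square
    by (simp add: S T Y0)
  moreover have "integrable unit_lborel (\<lambda>x. X.excess x ^ 2)"
    by (rule unit_lborel.integrable_bounded[where B = 1]) (simp_all add: abs_square_le_1 X.excess_bound)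
  ultimately have excess_AE: "AE x in unit_lborel. X.excess x = 0"
    by (subst (asm) integral_nonneg_eq_0_iff_AE) auto

  have I4: "{1..4} = {1, 2, 3, 4 :: nat}" and dist: "distinct [1, 2, 3, 4 :: nat]" by auto
  \<comment> \<open>The terms with all four points in one part agree for \<open>X\<close> and
    \<open>Y\<close>, and the stars integrate to 0; only the three 4-cycles of \<open>X\<close>
    remain.\<close>
  have "p * (1 - p) * (\<integral>x. \<integral>y. X.codegree x y ^ 2 \<partial>unit_lborel \<partial>unit_lborel) = 0"
    using prod_eq X.integral_prod_kernel[OF I4 dist excess_AE] Y.integral_prod_kernel[OF I4 dist]
    unfolding XK YK prod_vertex_pairs_4 by (simp add: S T Y0)
  moreover have g_int: "(\<integral>z. ?g z \<partial>(unit_lborel \<Otimes>\<^sub>M unit_lborel)) = 0"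
    using unit_lborel2.integral_fst'[OF unit_lborel2.P.integrable_bounded[OF X.g X.g_bound]] excess0
    by (simp add: X.excess_def)
  ultimately have "AE z in unit_lborel \<Otimes>\<^sub>M unit_lborel. ?g z = 0"
  proof -
    have gi: "integrable (unit_lborel \<Otimes>\<^sub>M unit_lborel) ?g"
      by (rule unit_lborel2.P.integrable_bounded[OF X.g X.g_bound])
    \<comment> \<open>For \<open>p\<close> equal to 0 or 1 the weight of the 4-cycles vanishes and
      the identity says nothing, so the vanishing mean \<open>g_int\<close> takes over.\<close>
    consider "p = 0" | "p = 1" | "(\<integral>x. \<integral>y. X.codegree x y ^ 2 \<partial>unit_lborel \<partial>unit_lborel) = 0"
      using \<open>p * (1 - p) * _ = 0\<close> by auto
    then show ?thesis
    proof cases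
      case 1
      have "0 \<le> ?g z" for z using v(2) 1 by (cases z) (auto simp: split_graphon_def)
      then show ?thesis using g_int integral_nonneg_eq_0_iff_AE[OF gi] by simp
    next
      case 2
      have "0 \<le> - ?g z" for z using v(2) 2 by (cases z) (auto simp: split_graphon_def)
      then have nonneg: "AE z in unit_lborel \<Otimes>\<^sub>M unit_lborel. 0 \<le> - ?g z" by (intro AE_I2)
      have "(\<integral>z. - ?g z \<partial>(unit_lborel \<Otimes>\<^sub>M unit_lborel)) = 0"
        unfolding Bochner_Integration.integral_minus g_int by simp
      then have "AE z in unit_lborel \<Otimes>\<^sub>M unit_lborel. - ?g z = 0"
        unfolding integral_nonneg_eq_0_iff_AE[OF integrable_minus[OF gi] nonneg] .
      then show ?thesis by eventually_elim simp
    next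
      case 3
      then show ?thesis by (rule X.AE_zero_if_codegree_zero)
    qed
  qed
  then have "AE z in unit_lborel \<Otimes>\<^sub>M unit_lborel. split_graphon S v z = split_graphon S (\<lambda>_. p) z"
    by eventually_elim simp
  \<comment> \<open>Two exchanges: \<open>v\<close> for the constant \<open>p\<close> by a.e.
    equality, then \<open>S\<close> for the interval \<open>T\<close> by equality of
    measures.\<close>
  then have "sample k U = sample k W" for k
    unfolding sU sW
    using sample_cong_AE[OF split_graphon_measurable[OF Sm pT(1)]] sample_split_graphon_cong[OF Sm Tm] S T
    by simp
  then show ?thesis by (simp add: weakly_isomorphic_def)
qed

end
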